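(* Let $n\geq 5$, let $\mathfrak{g}=\mathfrak{so}(n,\mathbb{C})$, and let $\lambda\in\mathbb{C}$ with $\lambda\neq-\frac{n-4}{4(n-1)(n-2)}$. Then the two-sided ideal in the tensor algebra $\bigotimes\mathfrak{g}$ generated by all elements $$X\otimes Y-X\circledcirc Y-\tfrac12[X,Y]-\lambda\langle X,Y\rangle,\qquad X,Y\in\mathfrak{g},$$ contains $\mathfrak{g}=\mathfrak{so}(n,\mathbb{C})$, the first graded piece of $\bigotimes\mathfrak{g}$.
   Context: For a complex simple Lie algebra $\mathfrak{g}$, $\bigotimes\mathfrak{g}=\bigoplus_{s\ge0}\bigotimes^s\mathfrak{g}$ is the full (unital, associative) tensor algebra over $\mathbb{C}$. The Cartan product $\mathfrak{g}\circledcirc\mathfrak{g}\subset\mathfrak{g}\otimes\mathfrak{g}$ is the unique irreducible component of $\mathfrak{g}\otimes\mathfrak{g}$ whose highest weight is twice the highest weight of $\mathfrak{g}$ (the adjoint representation). The map $X\otimes Y\mapsto X\circledcirc Y\in\mathfrak{g}\circledcirc\mathfrak{g}\subset\mathfrak{g}\otimes\mathfrak{g}$ denotes the $\mathfrak{g}$-invariant projection of $\mathfrak{g}\otimes\mathfrak{g}$ onto this component. $[X,Y]$ is the Lie bracket and $\langle X,Y\rangle=\mathrm{tr}(\mathrm{ad}_X\,\mathrm{ad}_Y)$ is the Killing form. The displayed generators are elements of $\bigotimes^2\mathfrak{g}\oplus\mathfrak{g}\oplus\mathbb{C}\subset\bigotimes\mathfrak{g}$. *)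

theory Defs
  imports "HOL-Analysis.Analysis" "HOL-Library.Poly_Mapping" "HOL-Algebra.Ideal"
begin

section \<open>Complex matrices and matrix Lie algebras\<close>

type_synonym 'n cmat = "complex ^ 'n ^ 'n"

definition mscale :: "complex \<Rightarrow> 'n::finite cmat \<Rightarrow> 'n cmat" where
  "mscale c A = map_matrix ((*) c) A"

interpretation gl: vector_space mscale
  by unfold_locales (simp_all add: mscale_def map_matrix_def vec_eq_iff algebra_simps)

definition lie_bracket :: "'n::finite cmat \<Rightarrow> 'n cmat \<Rightarrow> 'n cmat" where
  "lie_bracket X Y = X ** Y - Y ** X"

definition so :: "'n::finite cmat set" where
  "so = {X. transpose X = - X}"

text \<open>The trace of a complex-linear endomorphism \<open>f\<close> of a subspace \<open>V\<close>; it does not depend on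
  the chosen basis \<open>B\<close> of \<open>V\<close>, and \<open>gl.representation B v\<close> gives the coordinates of \<open>v\<close> in \<open>B\<close>.\<close>

definition trace_on :: "'n::finite cmat set \<Rightarrow> ('n cmat \<Rightarrow> 'n cmat) \<Rightarrow> complex" where
  "trace_on V f =
    (let B = (SOME B. B \<subseteq> V \<and> gl.independent B \<and> gl.span B = V)
     in \<Sum>v\<in>B. gl.representation B (f v) v)"

definition killing_form :: "'n::finite cmat set \<Rightarrow> 'n cmat \<Rightarrow> 'n cmat \<Rightarrow> complex" where
  "killing_form L X Y = trace_on L (lie_bracket X \<circ> lie_bracket Y)"

definition lie_subalgebra :: "'n::finite cmat set \<Rightarrow> bool" where
  "lie_subalgebra L \<longleftrightarrow> gl.subspace L \<and> (\<forall>X\<in>L. \<forall>Y\<in>L. lie_bracket X Y \<in> L)"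

definition derived_algebra :: "'n::finite cmat set \<Rightarrow> 'n cmat set" where
  "derived_algebra L = gl.span {lie_bracket X Y | X Y. X \<in> L \<and> Y \<in> L}"

definition solvable_lie :: "'n::finite cmat set \<Rightarrow> bool" where
  "solvable_lie L \<longleftrightarrow> (\<exists>k. (derived_algebra ^^ k) L = {0})"

definition borel_subalgebra :: "'n::finite cmat set \<Rightarrow> 'n cmat set \<Rightarrow> bool" where
  "borel_subalgebra L B \<longleftrightarrow>
     lie_subalgebra B \<and> B \<subseteq> L \<and> solvable_lie B \<and>
     (\<forall>B'. lie_subalgebra B' \<and> B' \<subseteq> L \<and> solvable_lie B' \<and> B \<subseteq> B' \<longrightarrow> B' = B)"


section \<open>The tensor algebra of a matrix Lie algebra\<close>

text \<open>The monoid of words under concatenation; its monoid algebra over the complex numbers is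
  then provided by the type of finitely supported functions on words.\<close>

instantiation list :: (type) monoid_add
begin
definition zero_list :: "'a list" where "zero_list = []"
definition plus_list :: "'a list \<Rightarrow> 'a list \<Rightarrow> 'a list" where "plus_list xs ys = xs @ ys"
instance by standard (simp_all add: zero_list_def plus_list_def)
end

text \<open>A tensor on \<open>n \<times> n\<close> matrices is given by its components: the coefficient at the word
  \<open>[(i\<^sub>1,j\<^sub>1), \<dots>, (i\<^sub>s,j\<^sub>s)]\<close> is the component with respect to
  \<open>E\<^bsub>i\<^sub>1j\<^sub>1\<^esub> \<otimes> \<dots> \<otimes> E\<^bsub>i\<^sub>sj\<^sub>s\<^esub>\<close>. The ring multiplication of this type is the tensor
  product: the component of \<open>iota X * iota Y\<close> at \<open>[(i,j),(k,l)]\<close> is \<open>X\<^bsub>ij\<^esub> Y\<^bsub>kl\<^esub>\<close>.\<close>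

type_synonym 'n tensor = "('n \<times> 'n) list \<Rightarrow>\<^sub>0 complex"

definition scalar :: "complex \<Rightarrow> 'n tensor" where
  "scalar c = Poly_Mapping.single [] c"

definition tscale :: "complex \<Rightarrow> 'n tensor \<Rightarrow> 'n tensor" where
  "tscale c t = scalar c * t"

definition iota :: "'n::finite cmat \<Rightarrow> 'n tensor" where
  "iota X = (\<Sum>i\<in>UNIV. \<Sum>j\<in>UNIV. Poly_Mapping.single [(i, j)] (X $ i $ j))"

lemma scalar_simps:
  "scalar 0 = 0" "scalar 1 = 1" "scalar (a + b) = scalar a + scalar b"
  "scalar (a * b) = scalar a * scalar b"
  using single_one[where 'a = "('n \<times> 'n) list"]
  by (simp_all add: scalar_def single_add mult_single plus_list_def zero_list_def)

lemma single_Nil: "Poly_Mapping.single [] 1 = (1 :: 'n tensor)"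
  using scalar_simps(2) by (simp add: scalar_def)

interpretation tens: vector_space tscale
  by unfold_locales (simp_all add: tscale_def scalar_simps algebra_simps)

definition tensor_power :: "'n::finite cmat set \<Rightarrow> nat \<Rightarrow> 'n tensor set" where
  "tensor_power L s = tens.span {prod_list (map iota Xs) | Xs. set Xs \<subseteq> L \<and> length Xs = s}"

text \<open>The tensor algebra of \<open>L\<close>, as a ring in the sense of HOL-Algebra. Since \<open>L\<close> is a subspace
  of the matrix space, its tensor powers are subspaces of those of the matrix space.\<close>

definition tensor_algebra :: "'n::finite cmat set \<Rightarrow> 'n tensor ring" where
  "tensor_algebra L =
     \<lparr>carrier = tens.span (\<Union>s. tensor_power L s), mult = (*), one = 1, zero = 0, add = (+)\<rparr>"

lemma tensor_sum_monomials:
  fixes t :: "'n tensor"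
  shows "t = (\<Sum>w\<in>Poly_Mapping.keys t. Poly_Mapping.single w (Poly_Mapping.lookup t w))"
  by (rule poly_mapping_eqI)
     (simp add: lookup_sum lookup_single when_def in_keys_iff sum.delta' if_distrib cong: if_cong)

lemma scalar_commute: "scalar c * t = t * scalar c" for t :: "'n tensor"
proof -
  have "scalar c * (\<Sum>w\<in>K. Poly_Mapping.single w (f w)) =
        (\<Sum>w\<in>K. Poly_Mapping.single w (f w)) * scalar c" for K :: "('n \<times> 'n) list set" and f
    by (simp add: sum_distrib_left sum_distrib_right scalar_def mult_single plus_list_def mult.commute)
  then show ?thesis
    using tensor_sum_monomials[of t] by metis
qed

lemma tscale_mult_left: "tscale c s * t = tscale c (s * t)" for s t :: "'n tensor"
  by (simp add: tscale_def mult.assoc)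

lemma tscale_mult_right: "s * tscale c t = tscale c (s * t)" for s t :: "'n tensor"
  by (metis mult.assoc scalar_commute tscale_def)

lemma span_mult_closed:
  fixes G :: "'n tensor set"
  assumes G: "\<And>a b. a \<in> G \<Longrightarrow> b \<in> G \<Longrightarrow> a * b \<in> tens.span G"
    and s: "s \<in> tens.span G" and t: "t \<in> tens.span G"
  shows "s * t \<in> tens.span G"
proof -
  have "a * t \<in> tens.span G" if a: "a \<in> G" for a
    using t
  proof (induction rule: tens.span_induct_alt)
    case base
    show ?case by (simp add: tens.span_zero)
  next
    case (step c x y)
    then show ?case
      by (simp add: distrib_left tscale_mult_right G[OF a] tens.span_add tens.span_scale)
  qed
  with s show ?thesis
  proof (induction rule: tens.span_induct_alt)
    case base
    show ?case by (simp add: tens.span_zero)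
  next
    case (step c x y)
    then show ?case
      by (simp add: distrib_right tscale_mult_left tens.span_add tens.span_scale)
  qed
qed

lemma carrier_tensor_algebra:
  "carrier (tensor_algebra L) = tens.span {prod_list (map iota Xs) | Xs. set Xs \<subseteq> L}"
proof -
  have "tens.span (\<Union>s. tensor_power L s) =
        tens.span {prod_list (map iota Xs) | Xs. set Xs \<subseteq> L}" (is "?l = ?r")
  proof
    have "tensor_power L s \<subseteq> ?r" for s
      unfolding tensor_power_def by (rule tens.span_mono) blast
    then show "?l \<subseteq> ?r"
      by (intro tens.span_minimal) auto
    have "prod_list (map iota Xs) \<in> tensor_power L (length Xs)" if "set Xs \<subseteq> L" for Xs
      unfolding tensor_power_def using that by (intro tens.span_base) blast
    then show "?r \<subseteq> ?l"
      by (intro tens.span_mono) blast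
  qed
  then show ?thesis by (simp add: tensor_algebra_def)
qed

lemma ring_tensor_algebra: "ring (tensor_algebra L)"
proof -
  let ?G = "{prod_list (map iota Xs) | Xs. set Xs \<subseteq> L}"
  let ?C = "tens.span ?G"
  have C: "carrier (tensor_algebra L) = ?C"
    by (rule carrier_tensor_algebra)
  have mult_G: "a * b \<in> ?C" if ab: "a \<in> ?G" "b \<in> ?G" for a b
  proof -
    obtain Xs Ys where "set Xs \<subseteq> L" "set Ys \<subseteq> L"
      "a = prod_list (map iota Xs)" "b = prod_list (map iota Ys)"
      using ab by blast
    then have "a * b = prod_list (map iota (Xs @ Ys))" "set (Xs @ Ys) \<subseteq> L"
      by auto
    then show ?thesis by (intro tens.span_base) blast
  qed
  have mult_C: "a * b \<in> ?C" if "a \<in> ?C" "b \<in> ?C" for a b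
    using span_mult_closed[OF mult_G that] .
  have one_C: "1 \<in> ?C"
    by (rule tens.span_base) (auto intro!: exI[of _ "[]"])
  show ?thesis
  proof (rule ringI)
    show "abelian_group (tensor_algebra L)"
    proof (rule abelian_groupI)
      fix x assume "x \<in> carrier (tensor_algebra L)"
      then have "- x \<in> carrier (tensor_algebra L)" by (simp add: C tens.span_neg)
      then show "\<exists>y\<in>carrier (tensor_algebra L).
          y \<oplus>\<^bsub>tensor_algebra L\<^esub> x = \<zero>\<^bsub>tensor_algebra L\<^esub>"
        by (rule bexI[rotated]) (simp add: tensor_algebra_def)
    qed (simp_all add: C, simp_all add: tensor_algebra_def tens.span_add tens.span_zero algebra_simps)
    show "monoid (tensor_algebra L)"
      by (rule monoidI)
         (simp_all add: C, simp_all add: tensor_algebra_def one_C mult_C mult.assoc)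
  qed (simp_all add: tensor_algebra_def algebra_simps)
qed


section \<open>The action on tensors and the Cartan square\<close>

definition matrix_unit :: "'n \<Rightarrow> 'n \<Rightarrow> 'n::finite cmat" where
  "matrix_unit i j = (\<chi> k l. if k = i \<and> l = j then 1 else 0)"

text \<open>\<open>tensor_act X\<close> is the derivation of the tensor algebra which extends the adjoint action
  \<open>[X, _]\<close>, see \<open>tensor_act_iota\<close> and \<open>tensor_act_mult\<close> below. It is first given on
  the basis words, by the Leibniz rule.\<close>

fun word_act :: "'n::finite cmat \<Rightarrow> ('n \<times> 'n) list \<Rightarrow> 'n tensor" where
  "word_act X [] = 0"
| "word_act X ((i, j) # w) =
     iota (lie_bracket X (matrix_unit i j)) * Poly_Mapping.single w 1 +
     iota (matrix_unit i j) * word_act X w"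

definition tensor_act :: "'n::finite cmat \<Rightarrow> 'n tensor \<Rightarrow> 'n tensor" where
  "tensor_act X t =
     (\<Sum>w\<in>Poly_Mapping.keys t. tscale (Poly_Mapping.lookup t w) (word_act X w))"

definition submodule_of :: "'n::finite cmat set \<Rightarrow> 'n tensor set \<Rightarrow> bool" where
  "submodule_of L W \<longleftrightarrow> tens.subspace W \<and> (\<forall>X\<in>L. \<forall>w\<in>W. tensor_act X w \<in> W)"

definition irreducible_submodule :: "'n::finite cmat set \<Rightarrow> 'n tensor set \<Rightarrow> bool" where
  "irreducible_submodule L W \<longleftrightarrow> submodule_of L W \<and> W \<noteq> {0} \<and>
     (\<forall>U. submodule_of L U \<and> U \<subseteq> W \<longrightarrow> U = {0} \<or> U = W)"

text \<open>Weights are taken as functionals on a Borel subalgebra \<open>B\<close> instead of on a Cartan subalgebra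
  of \<open>B\<close>: a highest weight vector of an irreducible module spans its unique \<open>B\<close>-stable line, on
  which the nilradical of \<open>B\<close> acts by zero.\<close>

definition has_highest_weight ::
    "'n::finite cmat set \<Rightarrow> 'n tensor set \<Rightarrow> ('n cmat \<Rightarrow> complex) \<Rightarrow> bool" where
  "has_highest_weight B W \<mu> \<longleftrightarrow>
     (\<exists>w\<in>W. w \<noteq> 0 \<and> (\<forall>X\<in>B. tensor_act X w = tscale (\<mu> X) w))"

text \<open>\<open>W\<close> is the Cartan product of \<open>L\<close> with itself. The adjoint representation is
  \<open>tensor_power L 1\<close>. As all Borel subalgebras are conjugate, the choice of \<open>B\<close> is immaterial.\<close>

definition cartan_square :: "'n::finite cmat set \<Rightarrow> 'n tensor set \<Rightarrow> bool" where
  "cartan_square L W \<longleftrightarrow>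
     W \<subseteq> tensor_power L 2 \<and> irreducible_submodule L W \<and>
     (\<exists>B \<theta>. borel_subalgebra L B \<and> has_highest_weight B (tensor_power L 1) \<theta> \<and>
        has_highest_weight B W (\<lambda>X. 2 * \<theta> X))"

definition invariant_projection ::
    "'n::finite cmat set \<Rightarrow> 'n tensor set \<Rightarrow> 'n tensor set \<Rightarrow> ('n tensor \<Rightarrow> 'n tensor) \<Rightarrow> bool"
where
  "invariant_projection L V W P \<longleftrightarrow>
     (\<forall>s\<in>V. \<forall>t\<in>V. P (s + t) = P s + P t) \<and>
     (\<forall>c. \<forall>t\<in>V. P (tscale c t) = tscale c (P t)) \<and>
     (\<forall>t\<in>V. P t \<in> W) \<and>
     (\<forall>t\<in>W. P t = t) \<and>
     (\<forall>X\<in>L. \<forall>t\<in>V. P (tensor_act X t) = tensor_act X (P t))"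

lemma tensor_act_superset:
  assumes "finite K" "Poly_Mapping.keys t \<subseteq> K"
  shows "tensor_act X t = (\<Sum>w\<in>K. tscale (Poly_Mapping.lookup t w) (word_act X w))"
  unfolding tensor_act_def using assms
  by (intro sum.mono_neutral_left) (auto simp: in_keys_iff)

lemma tensor_act_add: "tensor_act X (s + t) = tensor_act X s + tensor_act X t"
proof -
  let ?K = "Poly_Mapping.keys s \<union> Poly_Mapping.keys t"
  have "Poly_Mapping.keys (s + t) \<subseteq> ?K" by (rule Poly_Mapping.keys_add)
  then show ?thesis
    using tensor_act_superset[of ?K s X] tensor_act_superset[of ?K t X]
      tensor_act_superset[of ?K "s + t" X]
    by (simp add: lookup_add tens.scale_left_distrib sum.distrib)
qed

lemma tensor_act_single:
  "tensor_act X (Poly_Mapping.single w c) = tscale c (word_act X w)"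
  by (simp add: tensor_act_superset[of "{w}"])

lemma tensor_act_sum: "tensor_act X (sum f I) = (\<Sum>i\<in>I. tensor_act X (f i))"
proof (induction I rule: infinite_finite_induct)
  case (insert i I)
  then show ?case by (simp add: tensor_act_add)
qed (simp_all add: tensor_act_def)

lemma iota_matrix_unit: "iota (matrix_unit i j) = Poly_Mapping.single [(i, j)] 1"
proof -
  have "iota (matrix_unit i j) = (\<Sum>k\<in>UNIV. \<Sum>l\<in>UNIV.
      if k = i then (if l = j then Poly_Mapping.single [(k, l)] 1 else 0) else 0)"
    unfolding iota_def matrix_unit_def by (intro sum.cong refl) auto
  also have "\<dots> = Poly_Mapping.single [(i, j)] 1"
    by (subst sum.swap) simp
  finally show ?thesis .
qed

lemma word_act_append:
  "word_act X (u @ v) =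
     word_act X u * Poly_Mapping.single v 1 + Poly_Mapping.single u 1 * word_act X v"
proof (induction u)
  case Nil
  show ?case by (simp add: single_Nil)
next
  case (Cons a u)
  obtain i j where a: "a = (i, j)" by fastforce
  have "Poly_Mapping.single (u @ v) (1::complex) = Poly_Mapping.single u 1 * Poly_Mapping.single v 1"
    "Poly_Mapping.single (a # u) (1::complex) = Poly_Mapping.single [a] 1 * Poly_Mapping.single u 1"
    by (simp_all add: mult_single plus_list_def)
  with Cons show ?case
    by (simp add: a iota_matrix_unit algebra_simps)
qed

lemma tensor_act_mult: "tensor_act X (s * t) = tensor_act X s * t + s * tensor_act X t"
proof -
  have mono: "tensor_act X (Poly_Mapping.single u a * Poly_Mapping.single v b) =
      tensor_act X (Poly_Mapping.single u a) * Poly_Mapping.single v b +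
      Poly_Mapping.single u a * tensor_act X (Poly_Mapping.single v b)" for u v a b
  proof -
    have s: "Poly_Mapping.single w c = tscale c (Poly_Mapping.single w 1)"
      for w :: "('a \<times> 'a) list" and c
      by (simp add: tscale_def scalar_def mult_single plus_list_def)
    have "Poly_Mapping.single u a * Poly_Mapping.single v b = Poly_Mapping.single (u @ v) (a * b)"
      by (simp add: mult_single plus_list_def)
    then have "tensor_act X (Poly_Mapping.single u a * Poly_Mapping.single v b) =
        tscale (a * b) (word_act X u * Poly_Mapping.single v 1) +
        tscale (a * b) (Poly_Mapping.single u 1 * word_act X v)"
      by (simp only: tensor_act_single word_act_append tens.scale_right_distrib)
    also have "\<dots> = tscale a (word_act X u) * tscale b (Poly_Mapping.single v 1) +
        tscale a (Poly_Mapping.single u 1) * tscale b (word_act X v)"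
      by (simp only: tscale_mult_left tscale_mult_right tens.scale_scale mult.commute[of b a])
    finally show ?thesis
      by (simp only: tensor_act_single flip: s)
  qed
  let ?m = "\<lambda>t w. Poly_Mapping.single w (Poly_Mapping.lookup t w) :: 'a tensor"
  have "tensor_act X (sum (?m s) I * sum (?m t) J) =
      tensor_act X (sum (?m s) I) * sum (?m t) J + sum (?m s) I * tensor_act X (sum (?m t) J)"
    for I J
    by (simp add: sum_product tensor_act_sum mono sum.distrib)
  from this[of "Poly_Mapping.keys s" "Poly_Mapping.keys t"] show ?thesis
    by (simp only: tensor_sum_monomials[symmetric])
qed

lemma iota_add: "iota (X + Y) = iota X + iota Y"
  by (simp add: iota_def single_add sum.distrib)

lemma iota_mscale: "iota (mscale c X) = tscale c (iota X)"
  by (simp add: iota_def mscale_def map_matrix_def tscale_def scalar_def sum_distrib_left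
      mult_single plus_list_def)

lemma tensor_act_iota: "tensor_act X (iota Y) = iota (lie_bracket X Y)"
proof -
  have sums: "iota (sum f I) = (\<Sum>i\<in>I. iota (f i))" for f :: "'b \<Rightarrow> 'a cmat" and I
  proof (induction I rule: infinite_finite_induct)
    case (insert i I)
    then show ?case by (simp add: iota_add)
  qed (simp_all add: iota_def)
  have Y: "Y = (\<Sum>i\<in>UNIV. \<Sum>j\<in>UNIV. mscale (Y $ i $ j) (matrix_unit i j))"
  proof -
    have "(\<Sum>i\<in>UNIV. \<Sum>j\<in>UNIV. mscale (Y $ i $ j) (matrix_unit i j)) $ k $ l = Y $ k $ l" for k l
    proof -
      have "(\<Sum>i\<in>UNIV. \<Sum>j\<in>UNIV. mscale (Y $ i $ j) (matrix_unit i j)) $ k $ l =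
        (\<Sum>i\<in>UNIV. \<Sum>j\<in>UNIV. if i = k then (if j = l then Y $ i $ j else 0) else 0)"
        by (auto simp: mscale_def map_matrix_def matrix_unit_def intro!: sum.cong)
      also have "\<dots> = Y $ k $ l" by (subst sum.swap) simp
      finally show ?thesis .
    qed
    then show ?thesis by (simp add: vec_eq_iff)
  qed
  have add: "lie_bracket X (A + B) = lie_bracket X A + lie_bracket X B" for A B
    by (simp add: lie_bracket_def matrix_matrix_mult_def vec_eq_iff
        ring_distribs sum.distrib)
  have br_sum: "lie_bracket X (sum f I) = (\<Sum>i\<in>I. lie_bracket X (f i))"
    for f :: "'a \<Rightarrow> 'a cmat" and I
  proof (induction I rule: infinite_finite_induct)
    case (insert i I)
    then show ?case by (simp add: add)
  qed (simp_all add: lie_bracket_def)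
  have br_scale: "lie_bracket X (mscale c A) = mscale c (lie_bracket X A)" for c A
    by (simp add: lie_bracket_def mscale_def map_matrix_def matrix_matrix_mult_def vec_eq_iff
        sum_distrib_left algebra_simps)
  have "lie_bracket X Y =
      (\<Sum>i\<in>UNIV. \<Sum>j\<in>UNIV. mscale (Y $ i $ j) (lie_bracket X (matrix_unit i j)))"
    by (subst Y) (simp add: br_sum br_scale)
  moreover have "word_act X [(i, j)] = iota (lie_bracket X (matrix_unit i j))" for i j
    by (simp add: single_Nil)
  ultimately show ?thesis
    by (simp add: sums iota_mscale iota_def[of Y] tensor_act_sum tensor_act_single
        del: word_act.simps)
qed


end

theory Submission
  imports Defs "HOL-Computational_Algebra.Fundamental_Theorem_Algebra"
begin

text \<open>
  Write \<open>F\<^sub>a\<^sub>b\<close> for the skew matrix \<open>wedge e\<^sub>a e\<^sub>b\<close> of two standard basis vectors. Modulo the ideal, every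
  element \<open>t\<close> of the tensor square of \<open>so\<close> with \<open>P t = 0\<close> is equal to a tensor of lower degree, namely to half of its
  image under the bracket plus \<open>lam\<close> times its image under the Killing form. Two families of such
  tensors suffice: the pure traces \<open>\<Sum>\<^sub>b F\<^sub>a\<^sub>b \<otimes> F\<^sub>b\<^sub>d\<close>, called \<open>kappa\<close>, and the tensors
  \<open>F\<^sub>a\<^sub>b \<otimes> F\<^sub>c\<^sub>d + F\<^sub>a\<^sub>c \<otimes> F\<^sub>d\<^sub>b + F\<^sub>a\<^sub>d \<otimes> F\<^sub>b\<^sub>c\<close>, called \<open>omega\<close>. If the relation for the latter is multiplied by
  \<open>F\<^sub>d\<^sub>c\<close> and summed over \<open>c\<close> and \<open>d\<close>, then every cubic term contains a trace of the first kind
  (\<open>contraction\<close>). Reducing these traces turns the whole relation into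
  \<open>(n-2) (2 (n-1) (n-2) lam + (n-4)/2) F\<^sub>a\<^sub>b\<close> (\<open>wedge_in_ideal\<close>). The coefficient is nonzero by the assumption on
  \<open>lam\<close>, and the \<open>F\<^sub>a\<^sub>b\<close> span \<open>so\<close>. The constants require the bracket and the Killing form of
  the two families; the latter is \<open>(n-2)\<close> times the trace form (\<open>killing_form_so\<close>).

  It remains to see that \<open>P\<close> vanishes on the submodule \<open>M\<close> spanned by both families
  (\<open>projection_kills_non_weyl\<close>). If it does not, then \<open>P\<close> maps \<open>M\<close> onto the irreducible module \<open>W\<close>.
  Let \<open>x\<close> be the bivector of an isotropic plane. The square of its adjoint action maps \<open>so\<close> to the
  line of \<open>x\<close>, therefore \<open>x\<^sup>4\<close> maps the tensor square to the line of \<open>x \<otimes> x\<close>, and the image of \<open>M\<close> is zero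
  (\<open>raise_kills_non_weyl\<close>). Hence \<open>x\<^sup>4\<close> kills \<open>W\<close>. But \<open>x\<close> can be chosen in an \<open>sl\<^sub>2\<close>-triple \<open>(x, h, y)\<close>
  for which the highest weight vector \<open>w\<close> of \<open>W\<close> satisfies \<open>x w = 0\<close> and \<open>h w = 4 w\<close>, and then
  \<open>x\<^sup>4 y\<^sup>4 w\<close> is a nonzero multiple of \<open>w\<close> (\<open>raise_lower\<close>), a contradiction.

  The triple has to fit the given Borel subalgebra \<open>B\<close>, which is an arbitrary maximal solvable subalgebra.
  Lie's theorem (\<open>lie_theorem_relative\<close>) and
  maximality show that \<open>B\<close> stabilises an isotropic plane (\<open>borel_stabilises_isotropic_plane\<close>), that it contains
  \<open>x\<close>, \<open>h\<close> and the nilradical of the stabiliser of this plane (\<open>borel_contains_nilradical\<close>), and that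
  the highest weight of \<open>so\<close> takes the value 2 at \<open>h\<close> (\<open>highest_weight_on_h\<close>).
\<close>


section \<open>The complex orthogonal Lie algebra and bivectors\<close>

definition bilin :: "complex ^ 'n::finite \<Rightarrow> complex ^ 'n \<Rightarrow> complex" where
  "bilin x y = (\<Sum>i\<in>UNIV. x $ i * y $ i)"

text \<open>Under the identification of \<open>so\<close> with the exterior square of the standard module, this is
  the decomposable bivector of \<open>u\<close> and \<open>v\<close>.\<close>

definition wedge :: "complex ^ 'n::finite \<Rightarrow> complex ^ 'n \<Rightarrow> 'n cmat" where
  "wedge u v = (\<chi> i j. u $ i * v $ j - v $ i * u $ j)"

lemma bilin_simps [simp]:
  "bilin (x + y) z = bilin x z + bilin y z" "bilin z (x + y) = bilin z x + bilin z y"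
  "bilin (x - y) z = bilin x z - bilin y z" "bilin z (x - y) = bilin z x - bilin z y"
  "bilin (c *s x) z = c * bilin x z" "bilin z (c *s x) = c * bilin z x"
  "bilin (- x) z = - bilin x z" "bilin z (- x) = - bilin z x"
  "bilin 0 z = 0" "bilin z 0 = 0"
  by (simp_all add: bilin_def ring_distribs sum.distrib sum_subtractf sum_negf sum_distrib_left mult_ac)

lemma bilin_commute: "bilin x y = bilin y x"
  by (simp add: bilin_def mult.commute)

lemma bilin_axis [simp]: "bilin (axis i 1) x = x $ i" "bilin x (axis i 1) = x $ i"
proof -
  have "axis i 1 $ j * x $ j = (if j = i then x $ j else 0)" for j
    by (simp add: axis_def)
  then show "bilin (axis i 1) x = x $ i"
    by (simp add: bilin_def)
  then show "bilin x (axis i 1) = x $ i"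
    by (simp add: bilin_commute)
qed

lemma bilin_nondegenerate:
  assumes "\<And>y. bilin x y = 0"
  shows "x = 0"
  using assms[of "axis _ 1"] by (simp add: vec_eq_iff)

lemma so_component: "X \<in> so \<Longrightarrow> X $ i $ j = - X $ j $ i"
proof -
  assume "X \<in> so"
  then have "transpose X $ j $ i = (- X) $ j $ i"
    by (simp only: so_def mem_Collect_eq)
  then show "X $ i $ j = - X $ j $ i"
    by (simp add: transpose_def)
qed

lemma bilin_skew:
  assumes "X \<in> so"
  shows "bilin (X *v a) b = - bilin a (X *v b)"
proof -
  note X = so_component[OF assms]
  have "bilin (X *v a) b = (\<Sum>i\<in>UNIV. \<Sum>j\<in>UNIV. X $ i $ j * a $ j * b $ i)"
    by (simp add: bilin_def matrix_vector_mult_def sum_distrib_right)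
  also have "\<dots> = (\<Sum>j\<in>UNIV. \<Sum>i\<in>UNIV. X $ i $ j * a $ j * b $ i)"
    by (rule sum.swap)
  also have "\<dots> = (\<Sum>j\<in>UNIV. \<Sum>i\<in>UNIV. - (a $ j * (X $ j $ i * b $ i)))"
    by (intro sum.cong refl) (subst X, simp)
  also have "\<dots> = - bilin a (X *v b)"
    by (simp add: bilin_def matrix_vector_mult_def sum_distrib_left sum_negf)
  finally show ?thesis .
qed

lemma bilin_skew_self: "X \<in> so \<Longrightarrow> bilin (X *v a) a = 0"
  using bilin_skew[of X a a] bilin_commute[of a "X *v a"] by simp

lemma wedge_mult_vec: "wedge u v *v w = bilin v w *s u - bilin u w *s v"
  by (simp add: wedge_def bilin_def matrix_vector_mult_def vec_eq_iff left_diff_distrib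
      right_diff_distrib sum_subtractf sum_distrib_left sum_distrib_right mult_ac)

lemma wedge_in_so: "wedge u v \<in> so"
  by (simp add: so_def transpose_def wedge_def vec_eq_iff)

lemma lie_bracket_mult_vec: "lie_bracket X Y *v w = X *v (Y *v w) - Y *v (X *v w)"
  by (simp add: lie_bracket_def matrix_vector_mult_diff_rdistrib matrix_vector_mul_assoc)

lemma mscale_mult_vec: "mscale c X *v w = c *s (X *v w)"
  by (simp add: mscale_def map_matrix_def matrix_vector_mult_def vec_eq_iff sum_distrib_left mult_ac)

lemma mscale_component: "mscale c X $ i $ j = c * X $ i $ j"
  by (simp add: mscale_def map_matrix_def)

lemma wedge_simps:
  "wedge (u + u') v = wedge u v + wedge u' v" "wedge v (u + u') = wedge v u + wedge v u'"
  "wedge (u - u') v = wedge u v - wedge u' v" "wedge v (u - u') = wedge v u - wedge v u'"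
  "wedge (c *s u) v = mscale c (wedge u v)" "wedge v (c *s u) = mscale c (wedge v u)"
  "wedge 0 v = 0" "wedge v 0 = 0" "wedge v v = 0"
  "wedge (- u) v = - wedge u v" "wedge u (- v) = - wedge u v"
  by (simp_all add: wedge_def mscale_component vec_eq_iff algebra_simps)

lemma wedge_swap: "wedge v u = - wedge u v"
  by (simp add: wedge_def vec_eq_iff)

text \<open>The identification of bivectors with skew matrices is equivariant. All brackets below are
  computed from this rule, without matrix entries.\<close>

lemma lie_bracket_wedge:
  assumes "X \<in> so"
  shows "lie_bracket X (wedge u v) = wedge (X *v u) v + wedge u (X *v v)"
proof (subst matrix_eq, rule allI)
  fix w
  show "lie_bracket X (wedge u v) *v w = (wedge (X *v u) v + wedge u (X *v v)) *v w"
    by (simp add: lie_bracket_mult_vec matrix_vector_mult_add_rdistrib wedge_mult_vec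
        matrix_vector_mult_diff_distrib matrix_vector_mult_diff_rdistrib
        matrix_vector_right_distrib bilin_skew[OF assms] vector_scalar_commute)
qed

lemma lie_bracket_linear:
  "lie_bracket (X + X') Y = lie_bracket X Y + lie_bracket X' Y"
  "lie_bracket Y (X + X') = lie_bracket Y X + lie_bracket Y X'"
  "lie_bracket (mscale c X) Y = mscale c (lie_bracket X Y)"
  "lie_bracket Y (mscale c X) = mscale c (lie_bracket Y X)"
  "lie_bracket 0 Y = 0" "lie_bracket Y 0 = 0"
  by (simp_all add: lie_bracket_def matrix_matrix_mult_def mscale_component vec_eq_iff
      ring_distribs sum.distrib sum_subtractf sum_distrib_left right_diff_distrib mult_ac)

lemma lie_bracket_swap: "lie_bracket Y X = - lie_bracket X Y"
  by (simp add: lie_bracket_def)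

lemma lie_bracket_self: "lie_bracket X X = 0"
  by (simp add: lie_bracket_def)

lemma transpose_linear:
  "transpose (A + B) = transpose A + transpose (B :: 'n::finite cmat)"
  "transpose (A - B) = transpose A - transpose (B :: 'n::finite cmat)"
  "transpose (mscale c A) = mscale c (transpose (A :: 'n::finite cmat))"
  "transpose 0 = (0 :: 'n::finite cmat)"
  by (simp_all add: transpose_def vec_eq_iff mscale_component)

lemma mscale_uminus: "mscale c (- A) = - mscale c A"
  by (simp add: vec_eq_iff mscale_component)

lemma so_subspace: "gl.subspace so"
  by (auto simp: gl.subspace_def so_def transpose_linear mscale_uminus)

lemma matrix_mult_minus: "(- A) ** (- B) = A ** (B :: 'n::finite cmat)"
  by (simp add: matrix_matrix_mult_def vec_eq_iff)

lemma so_bracket: "X \<in> so \<Longrightarrow> Y \<in> so \<Longrightarrow> lie_bracket X Y \<in> so"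
  by (simp add: so_def lie_bracket_def matrix_transpose_mul transpose_linear matrix_mult_minus)

lemma finite_gl_basis:
  assumes "gl.subspace (V :: 'n::finite cmat set)"
  shows "\<exists>F. finite F \<and> F \<subseteq> V \<and> gl.independent F \<and> gl.span F = V"
proof -
  let ?T = "(\<lambda>(i, j). matrix_unit i j) ` UNIV :: 'n cmat set"
  have fin: "finite ?T"
    by simp
  have sp: "X \<in> gl.span ?T" for X :: "'n cmat"
  proof -
    have "X = (\<Sum>i\<in>UNIV. \<Sum>j\<in>UNIV. mscale (X $ i $ j) (matrix_unit i j))"
    proof -
      have "(\<Sum>i\<in>UNIV. \<Sum>j\<in>UNIV. mscale (X $ i $ j) (matrix_unit i j)) $ k $ l = X $ k $ l" for k l
      proof -
        have "(\<Sum>i\<in>UNIV. \<Sum>j\<in>UNIV. mscale (X $ i $ j) (matrix_unit i j)) $ k $ l =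
          (\<Sum>i\<in>UNIV. \<Sum>j\<in>UNIV. if i = k then (if j = l then X $ i $ j else 0) else 0)"
          by (auto simp: mscale_component matrix_unit_def intro!: sum.cong)
        also have "\<dots> = X $ k $ l" by (subst sum.swap) simp
        finally show ?thesis .
      qed
      then show ?thesis by (simp add: vec_eq_iff)
    qed
    also have "\<dots> \<in> gl.span ?T"
      by (intro gl.span_sum gl.span_scale gl.span_base) auto
    finally show ?thesis .
  qed
  obtain F where F: "F \<subseteq> V" "gl.independent F" "V \<subseteq> gl.span F"
    using gl.maximal_independent_subset[of V] by blast
  have "finite F"
    using gl.independent_span_bound[OF fin F(2)] sp by blast
  moreover have "gl.span F = V"
    using F assms by (metis gl.span_minimal subset_antisym)
  ultimately show ?thesis using F by blast
qed


section \<open>Weights and eigenvectors modulo a subspace\<close>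

text \<open>Quotients \<open>U / A\<close> of invariant subspaces are avoided by working modulo \<open>A\<close>: vectors are taken
  outside \<open>A\<close> and equations hold up to an element of \<open>A\<close>. The spaces below form the flag that \<open>z\<close> builds
  out of \<open>u\<close> modulo \<open>A\<close>.\<close>

definition orbit_span :: "'n::finite cmat \<Rightarrow> complex ^ 'n \<Rightarrow> (complex ^ 'n) set \<Rightarrow> nat \<Rightarrow> (complex ^ 'n) set" where
  "orbit_span z u A k = vec.span (A \<union> (\<lambda>i. (((*v) z) ^^ i) u) ` {..<k})"

lemma orbit_span_subspace: "vec.subspace (orbit_span z u A k)"
  by (simp add: orbit_span_def)

lemma orbit_span_0: "vec.subspace A \<Longrightarrow> orbit_span z u A 0 = A"
  by (simp add: orbit_span_def vec.span_eq_iff)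

lemma orbit_span_mono: "k \<le> l \<Longrightarrow> orbit_span z u A k \<subseteq> orbit_span z u A l"
  unfolding orbit_span_def by (intro vec.span_mono) auto

lemma orbit_span_base: "i < k \<Longrightarrow> (((*v) z) ^^ i) u \<in> orbit_span z u A k"
  unfolding orbit_span_def by (intro vec.span_base) auto

lemma subset_orbit_span: "A \<subseteq> orbit_span z u A k"
  unfolding orbit_span_def by (auto intro: vec.span_base)

lemma orbit_span_induct:
  assumes v: "v \<in> orbit_span z u A k" and "vec.subspace S"
    and A: "\<And>a. a \<in> A \<Longrightarrow> a \<in> S" and w: "\<And>i. i < k \<Longrightarrow> (((*v) z) ^^ i) u \<in> S"
  shows "v \<in> S"
proof -
  have "orbit_span z u A k \<subseteq> S"
    unfolding orbit_span_def using assms by (intro vec.span_minimal) auto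
  with v show ?thesis by blast
qed

lemma subspace_preimage:
  fixes X :: "'n::finite cmat"
  assumes "vec.subspace S"
  shows "vec.subspace {v. X *v v - c *s v \<in> S}"
proof -
  have lin: "X *v (x + y) - c *s (x + y) = (X *v x - c *s x) + (X *v y - c *s y)"
       "X *v (a *s x) - c *s (a *s x) = a *s (X *v x - c *s x)" for x y a
    by (simp_all add: matrix_vector_right_distrib vec.scale_right_distrib vec.scale_right_diff_distrib
        vector_scalar_commute mult.commute)
  have zero: "X *v 0 - c *s 0 = 0"
    by simp
  show ?thesis
    using assms unfolding vec.subspace_def mem_Collect_eq lin zero by blast
qed

lemma orbit_span_step:
  assumes "\<And>a. a \<in> A \<Longrightarrow> z *v a \<in> A" and "v \<in> orbit_span z u A k"
  shows "z *v v \<in> orbit_span z u A (Suc k)"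
proof -
  have "v \<in> {v. z *v v - 0 *s v \<in> orbit_span z u A (Suc k)}"
  proof (rule orbit_span_induct[OF assms(2) subspace_preimage[OF orbit_span_subspace]])
    fix i assume "i < k"
    then show "(((*v) z) ^^ i) u \<in> {v. z *v v - 0 *s v \<in> orbit_span z u A (Suc k)}"
      using orbit_span_base[of "Suc i" "Suc k" z u A] by simp
  qed (use assms(1) subset_orbit_span[of A z u "Suc k"] in auto)
  then show ?thesis by simp
qed

text \<open>While the flag grows, the dimension increases by one in each step, so the growth ends.\<close>

lemma orbit_span_stabilizes:
  assumes "vec.subspace A" "u \<notin> A"
  obtains k where "(((*v) z) ^^ k) u \<notin> orbit_span z u A k"
    "(((*v) z) ^^ Suc k) u \<in> orbit_span z u A (Suc k)"
proof -
  define Q where "Q m \<longleftrightarrow> (((*v) z) ^^ m) u \<in> orbit_span z u A m" for m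
  have "\<exists>m. Q m"
  proof (rule ccontr)
    assume "\<not> (\<exists>m. Q m)"
    then have n: "(((*v) z) ^^ m) u \<notin> orbit_span z u A m" for m
      by (auto simp: Q_def)
    have "m \<le> vec.dim (A \<union> (\<lambda>i. (((*v) z) ^^ i) u) ` {..<m})" for m
    proof (induction m)
      case (Suc m)
      have "A \<union> (\<lambda>i. (((*v) z) ^^ i) u) ` {..<Suc m} =
          insert ((((*v) z) ^^ m) u) (A \<union> (\<lambda>i. (((*v) z) ^^ i) u) ` {..<m})"
        by (auto simp: lessThan_Suc)
      with Suc n[of m] show ?case
        by (simp add: vec.dim_insert orbit_span_def del: funpow.simps)
    qed simp
    from this[of "Suc (vec.dim (UNIV :: (complex ^ 'a) set))"] show False
      using vec.dim_subset[OF subset_UNIV] by (meson not_less_eq_eq order_trans)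
  qed
  then obtain m where m: "Q m" "\<And>k. k < m \<Longrightarrow> \<not> Q k"
    by (metis exists_least_iff)
  have "m \<noteq> 0"
    using m(1) assms by (cases m) (auto simp: Q_def orbit_span_0)
  then obtain k where "m = Suc k"
    by (cases m) auto
  with m show ?thesis
    by (intro that[of k]) (auto simp: Q_def simp del: funpow.simps)
qed

text \<open>The invariance lemma behind Lie's theorem, modulo \<open>A\<close> and without traces. With
  \<open>w\<^sub>k = z\<^sup>k u\<close>, commuting \<open>j\<close> past the powers of \<open>z\<close> gives
  \<open>j w\<^sub>k\<^sub>+\<^sub>1 = mu(j) w\<^sub>k\<^sub>+\<^sub>1 + (k+1) mu([j,z]) w\<^sub>k\<close> up to lower terms of the flag. Let \<open>k\<close> be the step where
  \<open>w\<^sub>k\<^sub>+\<^sub>1\<close> falls into the span of \<open>A\<close> and \<open>w\<^sub>0, \<dots>, w\<^sub>k\<close>, while \<open>w\<^sub>k\<close> is not in the span of \<open>A\<close> and its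
  predecessors. As \<open>j - mu(j)\<close> lowers the flag by one step, the coefficient \<open>(k+1) mu([j,z])\<close> of \<open>w\<^sub>k\<close> must
  vanish, and the characteristic is zero.\<close>

lemma weight_vanishes_on_brackets:
  assumes A: "vec.subspace A" "\<And>X a. X \<in> insert z J \<Longrightarrow> a \<in> A \<Longrightarrow> X *v a \<in> A"
    and J: "\<And>j. j \<in> J \<Longrightarrow> lie_bracket j z \<in> J"
    and u: "u \<notin> A" "\<And>j. j \<in> J \<Longrightarrow> j *v u - mu j *s u \<in> A"
    and j: "j \<in> J"
  shows "mu (lie_bracket j z) = 0"
proof -
  define w where "w k = (((*v) z) ^^ k) u" for k
  let ?U = "orbit_span z u A"
  note sub = orbit_span_subspace[of z u A]
  have w_Suc: "w (Suc k) = z *v w k" for k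
    by (simp add: w_def)
  have wU: "i < k \<Longrightarrow> w i \<in> ?U k" for i k
    by (simp add: w_def orbit_span_base)
  have zU: "v \<in> ?U k \<Longrightarrow> z *v v \<in> ?U (Suc k)" for v k
    using A by (intro orbit_span_step) auto
  \<comment> \<open>The first part follows from the second one at \<open>k - 1\<close>, and it is needed for \<open>[j,z]\<close> in place of \<open>j\<close>.\<close>
  have both: "(\<forall>j\<in>J. j *v w k - mu j *s w k \<in> ?U k) \<and>
     (\<forall>j\<in>J. j *v w (Suc k) - mu j *s w (Suc k) - (of_nat (Suc k) * mu (lie_bracket j z)) *s w k \<in> ?U k)" for k
  proof (induction k)
    case 0
    have 1: "j *v w 0 - mu j *s w 0 \<in> ?U 0" if "j \<in> J" for j
      using u(2)[OF that] by (simp add: w_def orbit_span_0 A)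
    have "j *v w 1 - mu j *s w 1 - mu (lie_bracket j z) *s w 0 \<in> ?U 0" if j: "j \<in> J" for j
    proof -
      have "j *v w 1 - mu j *s w 1 - mu (lie_bracket j z) *s w 0 =
          z *v (j *v u - mu j *s u) + (lie_bracket j z *v u - mu (lie_bracket j z) *s u)"
        by (simp add: w_def lie_bracket_mult_vec matrix_vector_mult_diff_distrib vector_scalar_commute)
      also have "\<dots> \<in> A"
        using u(2)[OF j] u(2)[OF J[OF j]] A by (intro vec.subspace_add) auto
      finally show ?thesis
        by (simp add: orbit_span_0 A)
    qed
    with 1 show ?case by simp
  next
    case (Suc k)
    have 1: "j *v w (Suc k) - mu j *s w (Suc k) \<in> ?U (Suc k)" if "j \<in> J" for j
    proof -
      have "j *v w (Suc k) - mu j *s w (Suc k) - (of_nat (Suc k) * mu (lie_bracket j z)) *s w k \<in> ?U (Suc k)"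
        using Suc that orbit_span_mono[of k "Suc k" z u A] by auto
      moreover have "(of_nat (Suc k) * mu (lie_bracket j z)) *s w k \<in> ?U (Suc k)"
        by (intro vec.subspace_scale[OF sub] wU) simp
      ultimately show ?thesis
        using vec.subspace_add[OF sub] by fastforce
    qed
    moreover have "j *v w (Suc (Suc k)) - mu j *s w (Suc (Suc k)) -
        (of_nat (Suc (Suc k)) * mu (lie_bracket j z)) *s w (Suc k) \<in> ?U (Suc k)" if j: "j \<in> J" for j
    proof -
      let ?r = "j *v w (Suc k) - mu j *s w (Suc k) - (of_nat (Suc k) * mu (lie_bracket j z)) *s w k"
      have nat: "of_nat (Suc (Suc k)) * mu (lie_bracket j z) =
          of_nat (Suc k) * mu (lie_bracket j z) + mu (lie_bracket j z)"
        by (simp add: algebra_simps)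
      have "j *v w (Suc (Suc k)) - mu j *s w (Suc (Suc k)) -
        (of_nat (Suc (Suc k)) * mu (lie_bracket j z)) *s w (Suc k) =
        z *v ?r + (lie_bracket j z *v w (Suc k) - mu (lie_bracket j z) *s w (Suc k))"
        unfolding nat
        by (simp add: w_Suc lie_bracket_mult_vec matrix_vector_mult_diff_distrib vector_scalar_commute
            vec.scale_left_distrib matrix_vector_right_distrib del: of_nat_Suc)
      also have "\<dots> \<in> ?U (Suc k)"
        using Suc j 1[OF J[OF j]] by (intro vec.subspace_add[OF sub] zU) auto
      finally show ?thesis .
    qed
    ultimately show ?case by blast
  qed
  obtain k where k: "w k \<notin> ?U k" "w (Suc k) \<in> ?U (Suc k)"
    using orbit_span_stabilizes[OF A(1) u(1), of z] unfolding w_def by blast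
  have "w (Suc k) \<in> {v. j *v v - mu j *s v \<in> ?U k}"
  proof (rule orbit_span_induct[OF k(2) subspace_preimage[OF sub]])
    show "a \<in> {v. j *v v - mu j *s v \<in> ?U k}" if "a \<in> A" for a
      using that A j subset_orbit_span[of A z u k]
      by (auto intro!: vec.subspace_diff vec.subspace_scale sub)
    show "(((*v) z) ^^ i) u \<in> {v. j *v v - mu j *s v \<in> ?U k}" if "i < Suc k" for i
      using both[of i] j orbit_span_mono[of i k z u A] that by (auto simp: w_def)
  qed
  moreover have "j *v w (Suc k) - mu j *s w (Suc k) - (of_nat (Suc k) * mu (lie_bracket j z)) *s w k \<in> ?U k"
    using both[of k] j by blast
  ultimately have "(of_nat (Suc k) * mu (lie_bracket j z)) *s w k \<in> ?U k"
    using vec.subspace_diff[OF sub] by fastforce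
  moreover have "c = 0" if "c *s w k \<in> ?U k" for c
    using vec.subspace_scale[OF sub that, of "inverse c"] k(1) by (cases "c = 0") auto
  ultimately have "of_nat (Suc k) * mu (lie_bracket j z) = 0"
    by blast
  then show ?thesis
    by (simp del: of_nat_Suc)
qed

text \<open>The operator \<open>p(z)\<close>, applied to \<open>u\<close>.\<close>

definition poly_act :: "complex poly \<Rightarrow> 'n::finite cmat \<Rightarrow> complex ^ 'n \<Rightarrow> complex ^ 'n" where
  "poly_act p z u = (\<Sum>i\<le>degree p. coeff p i *s (((*v) z) ^^ i) u)"

lemma poly_act_bound:
  assumes "degree p \<le> m"
  shows "poly_act p z u = (\<Sum>i\<le>m. coeff p i *s (((*v) z) ^^ i) u)"
  unfolding poly_act_def using assms
  by (intro sum.mono_neutral_left) (auto simp: coeff_eq_0)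

lemma poly_act_add: "poly_act (p + q) z u = poly_act p z u + poly_act q z u"
proof -
  let ?m = "max (degree p) (degree q)"
  have "degree (p + q) \<le> ?m" by (rule degree_add_le_max)
  then show ?thesis
    by (simp add: poly_act_bound[of _ ?m] vec.scale_left_distrib sum.distrib)
qed

lemma poly_act_smult: "poly_act (smult c p) z u = c *s poly_act p z u"
  by (subst poly_act_bound[of _ "degree p"], simp only: degree_smult_le)
    (simp add: poly_act_def vec.scale_sum_right vector_smult_assoc)

lemma poly_act_pCons: "poly_act (pCons c p) z u = c *s u + z *v poly_act p z u"
proof -
  have "poly_act (pCons c p) z u = (\<Sum>i\<le>Suc (degree p). coeff (pCons c p) i *s (((*v) z) ^^ i) u)"
    by (rule poly_act_bound) (simp add: degree_pCons_le)
  also have "\<dots> = c *s u + (\<Sum>i\<le>degree p. coeff p i *s (z *v ((((*v) z) ^^ i) u)))"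
    by (subst sum.atMost_Suc_shift) simp
  finally show ?thesis
    by (simp add: poly_act_def vec.linear_sum[OF matrix_vector_mul_linear_gen] vector_scalar_commute)
qed

lemma poly_act_0: "poly_act 0 z u = 0"
  by (simp add: poly_act_def)

lemma poly_act_monom: "poly_act (monom 1 m) z u = (((*v) z) ^^ m) u"
  by (induction m) (simp_all add: monom_0 monom_Suc poly_act_pCons poly_act_0)

text \<open>If \<open>p\<close> is a nonzero polynomial of least degree with \<open>p(z) u\<close> in \<open>A\<close>, and \<open>p = (X - c) q\<close>, then
  \<open>q(z) u\<close> is an eigenvector modulo \<open>A\<close>.\<close>

lemma relative_eigenvector:
  fixes z :: "'n::finite cmat"
  assumes A: "vec.subspace A" and U: "vec.subspace U" "\<And>a. a \<in> U \<Longrightarrow> z *v a \<in> U"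
    and u: "u \<in> U" "u \<notin> A"
  shows "\<exists>v\<in>U - A. \<exists>c. z *v v - c *s v \<in> A"
proof -
  define Q where "Q d \<longleftrightarrow> (\<exists>p. p \<noteq> 0 \<and> degree p = d \<and> poly_act p z u \<in> A)" for d
  obtain k where k: "(((*v) z) ^^ Suc k) u \<in> orbit_span z u A (Suc k)"
    using orbit_span_stabilizes[OF A u(2), of z] by blast
  let ?S = "{v. \<exists>q. degree q \<le> k \<and> v - poly_act q z u \<in> A}"
  have "vec.subspace ?S"
    unfolding vec.subspace_def
  proof (intro conjI allI ballI)
    show "0 \<in> ?S"
      using vec.subspace_0[OF A] by (auto intro!: exI[of _ 0] simp: poly_act_0)
  next
    fix x y assume "x \<in> ?S" "y \<in> ?S"
    then obtain q r where "degree q \<le> k" "degree r \<le> k" "x - poly_act q z u \<in> A" "y - poly_act r z u \<in> A"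
      by blast
    then have "degree (q + r) \<le> k" "(x - poly_act q z u) + (y - poly_act r z u) \<in> A"
      by (auto intro: degree_add_le vec.subspace_add[OF A])
    then show "x + y \<in> ?S"
      by (auto intro!: exI[of _ "q + r"] simp: poly_act_add algebra_simps)
  next
    fix c x assume "x \<in> ?S"
    then obtain q where q: "degree q \<le> k" "x - poly_act q z u \<in> A"
      by blast
    have "c *s (x - poly_act q z u) \<in> A"
      using q by (intro vec.subspace_scale[OF A])
    then show "c *s x \<in> ?S"
      using q order_trans[OF degree_smult_le[of c q]]
      by (auto intro!: exI[of _ "smult c q"] simp: poly_act_smult vec.scale_right_diff_distrib)
  qed
  then have "(((*v) z) ^^ Suc k) u \<in> ?S"
  proof (rule orbit_span_induct[OF k])
    show "a \<in> ?S" if "a \<in> A" for a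
      using that by (auto intro!: exI[of _ 0] simp: poly_act_0)
    show "(((*v) z) ^^ i) u \<in> ?S" if "i < Suc k" for i
      using that vec.subspace_0[OF A] degree_monom_le[of "1 :: complex" i]
      by (auto intro!: exI[of _ "monom 1 i"] simp: poly_act_monom)
  qed
  then obtain q where q: "degree q \<le> k" "(((*v) z) ^^ Suc k) u - poly_act q z u \<in> A"
    by blast
  let ?p = "monom 1 (Suc k) + smult (- 1) q"
  have "coeff ?p (Suc k) = 1"
    using q(1) by (simp add: coeff_eq_0)
  then have "?p \<noteq> 0" by force
  moreover have "poly_act ?p z u \<in> A"
    using q(2) by (simp only: poly_act_add poly_act_monom poly_act_smult) (simp add: vec.scale_minus_left del: funpow.simps)
  ultimately have "\<exists>d. Q d"
    unfolding Q_def by blast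
  then obtain d where d: "Q d" "\<And>e. e < d \<Longrightarrow> \<not> Q e"
    by (metis exists_least_iff)
  from d(1) obtain p where p: "p \<noteq> 0" "degree p = d" "poly_act p z u \<in> A"
    unfolding Q_def by blast
  have "d \<noteq> 0"
  proof
    assume "d = 0"
    then obtain c where c: "p = [:c:]" "c \<noteq> 0"
      using p by (metis degree_eq_zeroE pCons_eq_0_iff)
    then have "inverse c *s (c *s u) \<in> A"
      using p(3) by (intro vec.subspace_scale[OF A, of "c *s u"]) (simp add: poly_act_pCons poly_act_0)
    then show False using u c by simp
  qed
  then have "\<not> constant (poly p)"
    using p(2) by (simp add: constant_degree)
  then obtain c where "poly p c = 0"
    using fundamental_theorem_of_algebra by blast
  then obtain q where q: "p = [:- c, 1:] * q"
    by (metis dvdE poly_eq_0_iff_dvd)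
  with p have q0: "q \<noteq> 0" "degree p = Suc (degree q)"
    by (auto simp: degree_mult_eq simp del: mult_pCons_left)
  let ?v = "poly_act q z u"
  have "?v \<notin> A"
    using d(2)[of "degree q"] q0 p(2) by (auto simp: Q_def)
  moreover have "poly_act r z u \<in> U" for r
  proof -
    have "(((*v) z) ^^ i) u \<in> U" for i
      by (induction i) (auto simp: u U)
    then show ?thesis
      unfolding poly_act_def by (intro vec.subspace_sum vec.subspace_scale U)
  qed
  moreover have "poly_act p z u = z *v ?v - c *s ?v"
  proof -
    have "p = smult (- c) q + pCons 0 q"
      by (simp add: q)
    then show ?thesis
      by (simp only: poly_act_add poly_act_smult poly_act_pCons) simp
  qed
  ultimately show ?thesis
    using p(3) by auto
qed


section \<open>Solvability, Borel subalgebras and Lie's theorem\<close>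

lemma derived_subset: "lie_subalgebra L \<Longrightarrow> derived_algebra L \<subseteq> L"
  unfolding derived_algebra_def lie_subalgebra_def
  by (intro gl.span_minimal) auto

lemma bracket_in_derived: "X \<in> L \<Longrightarrow> Y \<in> L \<Longrightarrow> lie_bracket X Y \<in> derived_algebra L"
  unfolding derived_algebra_def by (intro gl.span_base) auto

lemma derived_subspace: "gl.subspace (derived_algebra L)"
  by (simp add: derived_algebra_def)

lemma lie_subalgebraI:
  "gl.subspace L \<Longrightarrow> derived_algebra L \<subseteq> L \<Longrightarrow> lie_subalgebra L"
  unfolding lie_subalgebra_def using bracket_in_derived by blast

lemma derived_mono: "L \<subseteq> M \<Longrightarrow> derived_algebra L \<subseteq> derived_algebra M"
  unfolding derived_algebra_def by (intro gl.span_mono) blast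

lemma lie_subalgebra_derived: "lie_subalgebra L \<Longrightarrow> lie_subalgebra (derived_algebra L)"
  unfolding lie_subalgebra_def[of "derived_algebra L"]
  using derived_subset[of L] bracket_in_derived[of _ L] derived_subspace by blast

lemma derived_power_mono: "L \<subseteq> M \<Longrightarrow> (derived_algebra ^^ k) L \<subseteq> (derived_algebra ^^ k) M"
  by (induction k) (auto dest: derived_mono)

lemma derived_power_subspace: "gl.subspace L \<Longrightarrow> gl.subspace ((derived_algebra ^^ k) L)"
  by (cases k) (auto simp: derived_subspace)

text \<open>Solvability passes to extensions: it is enough that some derived algebra lies in a solvable one.\<close>

lemma solvable_if_derived_power:
  assumes L: "gl.subspace L" and sub: "(derived_algebra ^^ k) L \<subseteq> S" and S: "solvable_lie S"
  shows "solvable_lie L"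
proof -
  obtain m where m: "(derived_algebra ^^ m) S = {0}"
    using S by (auto simp: solvable_lie_def)
  have "(derived_algebra ^^ (m + k)) L \<subseteq> {0}"
    using derived_power_mono[OF sub, of m] m by (simp add: funpow_add)
  moreover have "0 \<in> (derived_algebra ^^ (m + k)) L"
    by (intro gl.subspace_0 derived_power_subspace L)
  ultimately show ?thesis
    unfolding solvable_lie_def by blast
qed

lemma derived_sum_subset:
  assumes B: "lie_subalgebra B" and N: "lie_subalgebra N"
    and BN: "\<And>b x. b \<in> B \<Longrightarrow> x \<in> N \<Longrightarrow> lie_bracket b x \<in> N"
  shows "derived_algebra {b + x | b x. b \<in> B \<and> x \<in> N} \<subseteq> {b + x | b x. b \<in> derived_algebra B \<and> x \<in> N}"
proof -
  have sub: "gl.subspace N"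
    using N by (simp add: lie_subalgebra_def)
  have "lie_bracket X Y \<in> {b + x | b x. b \<in> derived_algebra B \<and> x \<in> N}"
    if XY: "X \<in> {b + x | b x. b \<in> B \<and> x \<in> N}" "Y \<in> {b + x | b x. b \<in> B \<and> x \<in> N}" for X Y
  proof -
    obtain b x where 1: "X = b + x" "b \<in> B" "x \<in> N"
      using XY(1) by blast
    obtain c y where 2: "Y = c + y" "c \<in> B" "y \<in> N"
      using XY(2) by blast
    note * = 1(1) 2(1) 1(2) 2(2) 1(3) 2(3)
    have "lie_bracket X Y = lie_bracket b c + (lie_bracket b y - lie_bracket c x + lie_bracket x y)"
      using lie_bracket_swap[of c x] by (simp add: * lie_bracket_linear)
    moreover have "lie_bracket b y - lie_bracket c x + lie_bracket x y \<in> N"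
      using * BN N by (intro gl.subspace_add gl.subspace_diff sub) (auto simp: lie_subalgebra_def)
    ultimately show ?thesis
      using bracket_in_derived[OF *(3,4)] by blast
  qed
  moreover have "gl.subspace {b + x | b x. b \<in> derived_algebra B \<and> x \<in> N}"
    by (rule gl.subspace_sums[OF derived_subspace sub])
  ultimately show ?thesis
    unfolding derived_algebra_def[of "{b + x | b x. b \<in> B \<and> x \<in> N}"]
    by (intro gl.span_minimal) blast+
qed

lemma lie_subalgebra_sum:
  assumes B: "lie_subalgebra B" and N: "lie_subalgebra N"
    and BN: "\<And>b x. b \<in> B \<Longrightarrow> x \<in> N \<Longrightarrow> lie_bracket b x \<in> N"
  shows "lie_subalgebra {b + x | b x. b \<in> B \<and> x \<in> N}"
proof -
  have "{b + x | b x. b \<in> derived_algebra B \<and> x \<in> N} \<subseteq> {b + x | b x. b \<in> B \<and> x \<in> N}"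
    using derived_subset[OF B] by blast
  with derived_sum_subset[OF assms] have "derived_algebra {b + x | b x. b \<in> B \<and> x \<in> N}
      \<subseteq> {b + x | b x. b \<in> B \<and> x \<in> N}"
    by blast
  moreover have "gl.subspace {b + x | b x. b \<in> B \<and> x \<in> N}"
    using B N by (intro gl.subspace_sums) (auto simp: lie_subalgebra_def)
  ultimately show ?thesis
    by (intro lie_subalgebraI)
qed

lemma derived_power_sum_subset:
  assumes B: "lie_subalgebra B" and N: "lie_subalgebra N"
    and BN: "\<And>b x. b \<in> B \<Longrightarrow> x \<in> N \<Longrightarrow> lie_bracket b x \<in> N"
  shows "(derived_algebra ^^ k) {b + x | b x. b \<in> B \<and> x \<in> N}
    \<subseteq> {b + x | b x. b \<in> (derived_algebra ^^ k) B \<and> x \<in> N} \<and> lie_subalgebra ((derived_algebra ^^ k) B)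
    \<and> (derived_algebra ^^ k) B \<subseteq> B"
proof (induction k)
  case 0
  show ?case using B by auto
next
  case (Suc k)
  let ?D = "(derived_algebra ^^ k) B"
  have D: "lie_subalgebra ?D" "?D \<subseteq> B"
    using Suc by auto
  have "(derived_algebra ^^ Suc k) {b + x | b x. b \<in> B \<and> x \<in> N}
      \<subseteq> derived_algebra {b + x | b x. b \<in> ?D \<and> x \<in> N}"
    using Suc by (simp add: derived_mono)
  also have "\<dots> \<subseteq> {b + x | b x. b \<in> derived_algebra ?D \<and> x \<in> N}"
    using D by (intro derived_sum_subset N BN) auto
  finally show ?case
    using lie_subalgebra_derived[OF D(1)] derived_subset[OF D(1)] D(2) by auto
qed

text \<open>The derived series of \<open>B + N\<close> reaches \<open>N\<close> once that of \<open>B\<close> has vanished, hence \<open>B + N\<close> is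
  solvable, and \<open>B\<close> is maximal.\<close>

lemma borel_absorbs_solvable_normalised:
  assumes Bo: "borel_subalgebra so B"
    and N: "lie_subalgebra N" "solvable_lie N" "N \<subseteq> so"
    and BN: "\<And>b x. b \<in> B \<Longrightarrow> x \<in> N \<Longrightarrow> lie_bracket b x \<in> N"
  shows "N \<subseteq> B"
proof -
  let ?L = "{b + x | b x. b \<in> B \<and> x \<in> N}"
  have B: "lie_subalgebra B" "B \<subseteq> so" "solvable_lie B"
    using Bo by (auto simp: borel_subalgebra_def)
  have zero: "0 \<in> B" "0 \<in> N"
    using B N by (auto simp: lie_subalgebra_def gl.subspace_0)
  have L: "lie_subalgebra ?L"
    by (rule lie_subalgebra_sum[OF B(1) N(1) BN])
  obtain k where k: "(derived_algebra ^^ k) B = {0}"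
    using B(3) by (auto simp: solvable_lie_def)
  have "(derived_algebra ^^ k) ?L \<subseteq> N"
    using derived_power_sum_subset[OF B(1) N(1) BN, of k] k by auto
  then have "solvable_lie ?L"
    using L N(2) by (intro solvable_if_derived_power[of ?L k N]) (auto simp: lie_subalgebra_def)
  moreover have "?L \<subseteq> so"
    using B(2) N(3) by (auto intro!: gl.subspace_add[OF so_subspace])
  moreover have "B \<subseteq> ?L"
    using zero by force
  ultimately have "?L = B"
    using Bo L by (auto simp: borel_subalgebra_def)
  moreover have "N \<subseteq> ?L"
    using zero by force
  ultimately show ?thesis by blast
qed

text \<open>Borel subalgebras are self-normalising: the sum of \<open>B\<close> and the line of \<open>y\<close> has its derived algebra
  in \<open>B\<close>.\<close>

lemma borel_absorbs_normaliser:
  assumes Bo: "borel_subalgebra so B" and y: "y \<in> so"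
    and By: "\<And>b. b \<in> B \<Longrightarrow> lie_bracket b y \<in> B"
  shows "y \<in> B"
proof -
  let ?L = "{b + x | b x. b \<in> B \<and> x \<in> gl.span {y}}"
  have B: "lie_subalgebra B" "B \<subseteq> so" "solvable_lie B"
    using Bo by (auto simp: borel_subalgebra_def)
  have sB: "gl.subspace B"
    using B by (simp add: lie_subalgebra_def)
  have zero: "0 \<in> B" "0 \<in> gl.span {y}"
    using sB by (auto simp: gl.subspace_0 gl.span_zero)
  have bracket: "lie_bracket X Y \<in> B" if XY: "X \<in> ?L" "Y \<in> ?L" for X Y
  proof -
    obtain b x where 1: "X = b + x" "b \<in> B" "x \<in> gl.span {y}"
      using XY(1) by blast
    obtain c z where 2: "Y = c + z" "c \<in> B" "z \<in> gl.span {y}"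
      using XY(2) by blast
    note * = 1(1) 2(1) 1(2) 2(2) 1(3) 2(3)
    obtain s t where st: "x = mscale s y" "z = mscale t y"
      using *(5,6) by (auto simp: gl.span_singleton)
    have "lie_bracket X Y = lie_bracket b c + (mscale t (lie_bracket b y) - mscale s (lie_bracket c y))"
      using lie_bracket_swap[of c y] by (simp add: * st lie_bracket_linear lie_bracket_self mscale_uminus)
    also have "\<dots> \<in> B"
      using * B By by (intro gl.subspace_add gl.subspace_diff gl.subspace_scale sB) (auto simp: lie_subalgebra_def)
    finally show ?thesis .
  qed
  have subL: "gl.subspace ?L"
    by (intro gl.subspace_sums sB) simp
  have BL: "B \<subseteq> ?L"
    using zero by force
  have DL: "derived_algebra ?L \<subseteq> B"
    unfolding derived_algebra_def using bracket by (intro gl.span_minimal sB) blast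
  have "solvable_lie ?L"
    using DL B(3) subL by (intro solvable_if_derived_power[of ?L 1 B]) auto
  moreover have "lie_subalgebra ?L"
    by (rule lie_subalgebraI[OF subL order_trans[OF DL BL]])
  moreover have "?L \<subseteq> so"
    using B(2) y so_subspace gl.subspace_scale[OF so_subspace y]
    by (auto simp: gl.span_singleton intro!: gl.subspace_add[OF so_subspace])
  ultimately have "?L = B"
    using Bo BL by (auto simp: borel_subalgebra_def)
  moreover have "y \<in> ?L"
    using zero gl.span_base[of y "{y}"] by force
  ultimately show ?thesis by blast
qed

text \<open>Lie's theorem for the quotient of \<open>U\<close> by \<open>A\<close>. By induction, the derived algebra has a common
  eigenvector. Elements \<open>z\<close> of \<open>L\<close> are then adjoined one at a time to a subspace \<open>J\<close> above the derived
  algebra. Such a \<open>J\<close> is an ideal, so its weight space is stable under \<open>z\<close>, by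
  \<open>weight_vanishes_on_brackets\<close>, and contains an eigenvector of \<open>z\<close>.\<close>

lemma lie_theorem_relative:
  assumes "lie_subalgebra L" "(derived_algebra ^^ k) L = {0}"
    and "vec.subspace U" "vec.subspace A" "A \<subset> U"
    and "\<And>X a. X \<in> L \<Longrightarrow> a \<in> A \<Longrightarrow> X *v a \<in> A"
    and "\<And>X a. X \<in> L \<Longrightarrow> a \<in> U \<Longrightarrow> X *v a \<in> U"
  shows "\<exists>u\<in>U - A. \<forall>X\<in>L. \<exists>c. X *v u - c *s u \<in> A"
  using assms
proof (induction k arbitrary: L)
  case 0
  then obtain u where "u \<in> U - A" "L = {0}" by auto
  with 0 show ?case
    by (intro bexI[of _ u]) (auto intro!: exI[of _ 0] simp: vec.subspace_0)
next
  case (Suc k)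
  note A = \<open>vec.subspace A\<close> and U = \<open>vec.subspace U\<close>
  let ?D = "derived_algebra L"
  have DL: "?D \<subseteq> L"
    using Suc.prems by (simp add: derived_subset)
  have subL: "gl.subspace L"
    using Suc.prems by (simp add: lie_subalgebra_def)
  have extend: "\<exists>u\<in>U - A. \<forall>X\<in>gl.span (?D \<union> F). \<exists>c. X *v u - c *s u \<in> A"
    if "finite F" "F \<subseteq> L" for F
    using that
  proof (induction F rule: finite_induct)
    case empty
    have "(derived_algebra ^^ k) ?D = {0}"
      using Suc.prems(2) by (simp add: funpow_swap1)
    then have "\<exists>u\<in>U - A. \<forall>X\<in>?D. \<exists>c. X *v u - c *s u \<in> A"
      using Suc.prems DL by (intro Suc.IH lie_subalgebra_derived) auto
    then show ?case
      using gl.span_eq_iff derived_subspace by (metis Un_empty_right)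
  next
    case (insert z F)
    let ?J = "gl.span (?D \<union> F)"
    have JL: "?J \<subseteq> L"
      using DL insert.prems by (intro gl.span_minimal subL) auto
    have z: "z \<in> L"
      using insert.prems by simp
    have Jz: "lie_bracket j z \<in> ?J" if "j \<in> ?J" for j
      using that JL z by (intro gl.span_base UnI1 bracket_in_derived) auto
    obtain u where u: "u \<in> U - A" "\<forall>X\<in>?J. \<exists>c. X *v u - c *s u \<in> A"
      using insert by auto
    then obtain mu where mu: "\<And>X. X \<in> ?J \<Longrightarrow> X *v u - mu X *s u \<in> A"
      by metis
    \<comment> \<open>The weight space of \<open>J\<close> for the weight \<open>mu\<close>, modulo \<open>A\<close>.\<close>
    let ?W = "U \<inter> (\<Inter>j\<in>?J. {v. j *v v - mu j *s v \<in> A})"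
    have W: "vec.subspace ?W"
      using U by (intro vec.subspace_inter vec.subspace_Inter) (auto intro: subspace_preimage[OF A])
    have "z *v v \<in> ?W" if v: "v \<in> ?W" for v
    proof -
      have "j *v (z *v v) - mu j *s (z *v v) \<in> A" if j: "j \<in> ?J" for j
      proof -
        have "mu (lie_bracket j z) = 0"
          using u mu j Jz z JL Suc.prems(6)
          by (intro weight_vanishes_on_brackets[OF A, where z = z and J = ?J and u = u]) auto
        then have "lie_bracket j z *v v \<in> A"
          using v Jz[OF j] by force
        moreover have "z *v (j *v v - mu j *s v) \<in> A"
          using v j Suc.prems(6)[OF z] by blast
        moreover have "j *v (z *v v) - mu j *s (z *v v) = z *v (j *v v - mu j *s v) + lie_bracket j z *v v"
          by (simp add: lie_bracket_mult_vec matrix_vector_mult_diff_distrib vector_scalar_commute)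
        ultimately show ?thesis
          using vec.subspace_add[OF A] by simp
      qed
      then show ?thesis
        using v Suc.prems(7)[OF z] by blast
    qed
    moreover have "u \<in> ?W" "u \<notin> A"
      using u mu by auto
    ultimately obtain v c where v: "v \<in> ?W - A" "z *v v - c *s v \<in> A"
      using relative_eigenvector[OF A W, of z u] by blast
    have "\<exists>d. X *v v - d *s v \<in> A" if X: "X \<in> gl.span (?D \<union> insert z F)" for X
    proof -
      obtain e where e: "X - mscale e z \<in> ?J"
        using X gl.span_insert[of z "?D \<union> F"] by (auto simp: Un_insert_right)
      then have "(X - mscale e z) *v v - mu (X - mscale e z) *s v \<in> A"
        using v by blast
      moreover have "e *s (z *v v - c *s v) \<in> A"
        using v by (intro vec.subspace_scale A)
      ultimately have "((X - mscale e z) *v v - mu (X - mscale e z) *s v) + e *s (z *v v - c *s v) \<in> A"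
        by (intro vec.subspace_add A)
      moreover have "((X - mscale e z) *v v - mu (X - mscale e z) *s v) + e *s (z *v v - c *s v) =
          X *v v - (mu (X - mscale e z) + e * c) *s v"
        by (simp add: matrix_vector_mult_diff_rdistrib mscale_mult_vec vec.scale_right_diff_distrib
            vec.scale_left_distrib)
      ultimately show ?thesis by metis
    qed
    then show ?case
      using v by blast
  qed
  obtain F where F: "finite F" "F \<subseteq> L" "gl.span F = L"
    using finite_gl_basis[OF subL] by blast
  have "L \<subseteq> gl.span (?D \<union> F)"
    using F(3) gl.span_mono[of F "?D \<union> F"] by blast
  with extend[OF F(1,2)] show ?case
    by blast
qed


section \<open>Isotropic planes stable under a Borel subalgebra\<close>

text \<open>Fewer than \<open>n\<close> linear equations in \<open>n\<close> unknowns: a square matrix whose rows are the given vectors has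
  a row space that is too small.\<close>

lemma exists_orthogonal_vector:
  fixes S :: "(complex ^ 'n::finite) set"
  assumes "finite S" "card S < CARD('n)"
  shows "\<exists>f. f \<noteq> 0 \<and> (\<forall>s\<in>S. bilin s f = 0)"
proof (cases "S = {}")
  case True
  then show ?thesis
    by (intro exI[of _ "axis undefined 1"]) (simp add: axis_eq_0_iff)
next
  case False
  then obtain g :: "'n \<Rightarrow> complex ^ 'n" where g: "range g = S"
    using assms by (metis card_le_inj ex_bij_betw_finite_nat finite_class.finite_UNIV inj_on_iff_surj less_imp_le)
  let ?A = "(\<chi> i. g i) :: 'n cmat"
  have rows: "rows ?A = S"
    using g by (auto simp: rows_def row_def)
  have "\<not> (\<exists>B. B ** ?A = mat 1)"
  proof
    assume "\<exists>B. B ** ?A = mat 1"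
    then have "vec.span S = UNIV"
      using rows by (simp add: matrix_left_invertible_span_rows_gen)
    then have "vec.dim (UNIV :: (complex ^ 'n) set) \<le> card S"
      using vec.dim_le_card[of UNIV S] assms(1) by simp
    then show False
      using assms(2) by (simp add: vec.dim_UNIV card_cart_basis)
  qed
  then obtain f where f: "?A *v f = 0" "f \<noteq> 0"
    unfolding matrix_left_invertible_ker by blast
  have "bilin (g i) f = (?A *v f) $ i" for i
    by (simp add: matrix_vector_mult_def bilin_def)
  then show ?thesis
    using f g by (intro exI[of _ f]) auto
qed

lemma bilin_eq_1_exists:
  assumes "a \<noteq> 0"
  shows "\<exists>g. bilin a g = 1"
proof -
  obtain y where "bilin a y \<noteq> 0"
    using bilin_nondegenerate[of a] assms by blast
  then have "bilin a (inverse (bilin a y) *s y) = 1"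
    by simp
  then show ?thesis by blast
qed

text \<open>One more equation, \<open>bilin g f = 0\<close> with \<open>bilin a g = 1\<close>, keeps \<open>f\<close> off the line of \<open>a\<close>.\<close>

lemma exists_orthogonal_independent:
  fixes S :: "(complex ^ 'n::finite) set"
  assumes "finite S" "card S + 1 < CARD('n)"
  shows "\<exists>f. f \<notin> vec.span {a} \<and> (\<forall>s\<in>S. bilin s f = 0)"
proof -
  obtain g where g: "a \<noteq> 0 \<Longrightarrow> bilin a g = 1"
    using bilin_eq_1_exists by blast
  have "card (insert g S) < CARD('n)"
    using assms card_insert_le_m1[of "Suc (card S)" S g] card_insert_if[of S g] by simp
  then obtain f where f: "f \<noteq> 0" "\<forall>s\<in>insert g S. bilin s f = 0"
    using exists_orthogonal_vector[of "insert g S"] assms by blast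
  have "f \<notin> vec.span {a}"
  proof
    assume "f \<in> vec.span {a}"
    then obtain c where c: "f = c *s a"
      by (auto simp: vec.span_singleton)
    then have "a \<noteq> 0" "c \<noteq> 0"
      using f(1) by auto
    then show False
      using f(2) c g bilin_commute[of g a] by auto
  qed
  with f show ?thesis by blast
qed

lemma abelian_lie_subalgebra:
  assumes "gl.subspace N" and N: "\<And>x y. x \<in> N \<Longrightarrow> y \<in> N \<Longrightarrow> lie_bracket x y = 0"
  shows "lie_subalgebra N" "solvable_lie N"
proof -
  show "lie_subalgebra N"
    using assms by (simp add: lie_subalgebra_def gl.subspace_0)
  have "{lie_bracket X Y | X Y. X \<in> N \<and> Y \<in> N} \<subseteq> {0}"
    using N by blast
  then have "derived_algebra N \<subseteq> {0}"
    unfolding derived_algebra_def by (intro gl.span_minimal) simp_all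
  then have "(derived_algebra ^^ 1) N = {0}"
    using gl.subspace_0[OF derived_subspace[of N]] by auto
  then show "solvable_lie N"
    unfolding solvable_lie_def by blast
qed

lemma subspace_orthogonal: "vec.subspace {f. bilin a f = 0}"
  by (auto simp: vec.subspace_def)

text \<open>A skew matrix is infinitesimally orthogonal, so it cannot rescale a vector \<open>u\<close> of nonzero length, not
  even up to a vector orthogonal to \<open>u\<close>.\<close>

lemma eigenvalue_zero_if_anisotropic:
  assumes X: "X \<in> so" and u: "bilin u u \<noteq> 0" "bilin a u = 0"
    and eig: "X *v u - c *s u \<in> vec.span {a}"
  shows "X *v u \<in> vec.span {a}"
proof -
  obtain d where d: "X *v u - c *s u = d *s a"
    using eig by (auto simp: vec.span_singleton)
  then have "X *v u = c *s u + d *s a"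
    by (simp add: algebra_simps)
  then have "bilin (X *v u) u = c * bilin u u"
    using u(2) by simp
  then have "c = 0"
    using bilin_skew_self[OF X, of u] u(1) by simp
  then show ?thesis
    using eig by simp
qed

text \<open>Lie's theorem gives a \<open>B\<close>-eigenvector \<open>u\<close> in the quotient of the orthogonal space of \<open>a\<close> by the line of
  \<open>a\<close>. If \<open>u\<close> is anisotropic, then \<open>B\<close> kills it modulo \<open>a\<close>, and Lie's theorem gives a second eigenvector
  \<open>w\<close>, orthogonal to \<open>a\<close> and \<open>u\<close>. If \<open>w\<close> is anisotropic as well, then the infinitesimal rotation
  \<open>wedge u w\<close> normalises \<open>B\<close> and so belongs to \<open>B\<close>. But it maps \<open>u\<close> to a nonzero multiple of
  \<open>w\<close>, and not to a multiple of \<open>a\<close>. The lemma is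
  used for \<open>a = 0\<close>, where it yields a stable isotropic line, and then for a vector on that line.\<close>

lemma isotropic_extension:
  fixes B :: "'n::finite cmat set"
  assumes n: "CARD('n) \<ge> 5" and Bo: "borel_subalgebra so B"
    and a: "bilin a a = 0" and Ba: "\<And>b. b \<in> B \<Longrightarrow> \<exists>c. b *v a = c *s a"
  shows "\<exists>u. u \<notin> vec.span {a} \<and> bilin a u = 0 \<and> bilin u u = 0 \<and>
    (\<forall>b\<in>B. \<exists>c d. b *v u = c *s u + d *s a)"
proof -
  have B: "lie_subalgebra B" "B \<subseteq> so" "solvable_lie B"
    using Bo by (auto simp: borel_subalgebra_def)
  then obtain k where k: "(derived_algebra ^^ k) B = {0}"
    by (auto simp: solvable_lie_def)
  have skew: "bilin (b *v x) y = - bilin x (b *v y)" if "b \<in> B" for b x y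
    using that B by (intro bilin_skew) auto
  have inv_a: "bilin a (b *v f) = 0" if "b \<in> B" "bilin a f = 0" for b f
    using skew[of b a f] Ba[of b] that by auto
  \<comment> \<open>For nonzero \<open>a\<close>, the abelian nilradical of the stabiliser of the line of \<open>a\<close>.\<close>
  define N where "N = {wedge a f | f. bilin a f = 0}"
  have "N \<subseteq> B"
  proof (rule borel_absorbs_solvable_normalised[OF Bo])
    have sub: "gl.subspace N"
      unfolding gl.subspace_def
    proof (intro conjI allI ballI)
      show "0 \<in> N" by (auto simp: N_def wedge_simps intro!: exI[of _ 0])
    next
      fix x y assume "x \<in> N" "y \<in> N"
      then obtain f g where "x = wedge a f" "y = wedge a g" "bilin a f = 0" "bilin a g = 0"
        by (auto simp: N_def)
      then show "x + y \<in> N"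
        by (auto simp: N_def wedge_simps intro!: exI[of _ "f + g"])
    next
      fix c x assume "x \<in> N"
      then obtain f where "x = wedge a f" "bilin a f = 0"
        by (auto simp: N_def)
      then show "mscale c x \<in> N"
        by (auto simp: N_def wedge_simps intro!: exI[of _ "c *s f"])
    qed
    have abel: "lie_bracket x y = 0" if xy: "x \<in> N" "y \<in> N" for x y
    proof -
      obtain f g where "x = wedge a f" "y = wedge a g" "bilin a f = 0" "bilin a g = 0"
        using xy by (auto simp: N_def)
      moreover from this have "bilin f a = 0"
        by (simp add: bilin_commute[of f a])
      ultimately show ?thesis
        using a by (simp add: lie_bracket_wedge[OF wedge_in_so] wedge_mult_vec wedge_simps)
    qed
    show "lie_subalgebra N" "solvable_lie N"
      using abelian_lie_subalgebra[OF sub abel] by auto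
    show "N \<subseteq> so"
      by (auto simp: N_def wedge_in_so)
    fix b x assume b: "b \<in> B" and "x \<in> N"
    then obtain f where f: "x = wedge a f" "bilin a f = 0"
      by (auto simp: N_def)
    obtain c where c: "b *v a = c *s a"
      using Ba b by blast
    have "lie_bracket b x = wedge a (c *s f + b *v f)"
      using b B by (simp add: f lie_bracket_wedge subsetD c wedge_simps)
    then show "lie_bracket b x \<in> N"
      using f inv_a[OF b] by (auto simp: N_def intro!: exI[of _ "c *s f + b *v f"])
  qed
  let ?A = "vec.span {a}"
  have invA: "X *v x \<in> ?A" if "X \<in> B" "x \<in> ?A" for X x
    using that Ba[of X] by (auto simp: vec.span_singleton vector_scalar_commute)
  have Asub: "?A \<subseteq> {f. bilin a f = 0}"
    using a by (auto simp: vec.span_singleton)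
  have AV: "?A \<subset> {f. bilin a f = 0}"
    using Asub exists_orthogonal_independent[of "{a}" a] n by auto
  then obtain u where u: "bilin a u = 0" "u \<notin> ?A" "\<forall>b\<in>B. \<exists>c. b *v u - c *s u \<in> ?A"
    using lie_theorem_relative[OF B(1) k subspace_orthogonal vec.subspace_span AV invA] inv_a by blast
  have finish: ?thesis if w: "w \<notin> ?A" "bilin a w = 0" "bilin w w = 0"
    "\<forall>b\<in>B. \<exists>c. b *v w - c *s w \<in> ?A" for w
  proof -
    have "\<exists>c d. b *v w = c *s w + d *s a" if "b \<in> B" for b
      using w(4) that by (force simp: vec.span_singleton algebra_simps)
    with w show ?thesis by blast
  qed
  show ?thesis
  proof (cases "bilin u u = 0")
    case True
    with u finish show ?thesis by blast
  next
    case False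
    have Bu: "b *v u \<in> ?A" if "b \<in> B" for b
      using that u B eigenvalue_zero_if_anisotropic[of b u a] False by blast
    let ?U = "{f. bilin a f = 0} \<inter> {f. bilin u f = 0}"
    have inv_u: "bilin u (b *v f) = 0" if b: "b \<in> B" and "bilin a f = 0" for b f
    proof -
      obtain c where "b *v u = c *s a"
        using Bu[OF b] by (auto simp: vec.span_singleton)
      then show ?thesis
        using skew[OF b, of u f] that by simp
    qed
    have "?A \<subseteq> ?U"
      using Asub u by (auto simp: vec.span_singleton bilin_commute[of u a])
    moreover have "\<exists>f. f \<notin> ?A \<and> (\<forall>s\<in>{a, u}. bilin s f = 0)"
      using n card_insert_le_m1[of 2 "{u}" a] by (intro exists_orthogonal_independent) auto
    ultimately have AU: "?A \<subset> ?U"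
      by auto
    then obtain w where w: "bilin a w = 0" "bilin u w = 0" "w \<notin> ?A" "\<forall>b\<in>B. \<exists>c. b *v w - c *s w \<in> ?A"
      using lie_theorem_relative[OF B(1) k vec.subspace_inter[OF subspace_orthogonal subspace_orthogonal]
          vec.subspace_span AU invA] inv_a inv_u by blast
    show ?thesis
    proof (cases "bilin w w = 0")
      case True
      with w finish show ?thesis by blast
    next
      case nz: False
      have Bw: "b *v w \<in> ?A" if "b \<in> B" for b
        using that w B eigenvalue_zero_if_anisotropic[of b w a] nz by blast
      have "wedge u w \<in> B"
      proof (rule borel_absorbs_normaliser[OF Bo wedge_in_so])
        fix b assume b: "b \<in> B"
        obtain c d where cd: "b *v u = c *s a" "b *v w = d *s a"
          using Bu[OF b] Bw[OF b] by (auto simp: vec.span_singleton)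
        have "lie_bracket b (wedge u w) = wedge a (c *s w - d *s u)"
          using b B by (simp add: lie_bracket_wedge subsetD cd wedge_simps wedge_swap[of u a] mscale_uminus)
        moreover have "wedge a (c *s w - d *s u) \<in> N"
          unfolding N_def using w u by (intro CollectI exI[of _ "c *s w - d *s u"]) simp
        ultimately show "lie_bracket b (wedge u w) \<in> B"
          using \<open>N \<subseteq> B\<close> by auto
      qed
      then have "wedge u w *v u \<in> ?A"
        by (rule Bu)
      then have "(- 1 / bilin u u) *s (wedge u w *v u) \<in> ?A"
        by (rule vec.span_scale)
      then have "w \<in> ?A"
        using False w by (simp add: wedge_mult_vec bilin_commute[of w u] vec.scale_minus_left)
      with w show ?thesis by blast
    qed
  qed
qed

lemma borel_stabilises_isotropic_plane:
  fixes B :: "'n::finite cmat set"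
  assumes n: "CARD('n) \<ge> 5" and Bo: "borel_subalgebra so B"
  obtains u v where "v \<noteq> 0" "u \<notin> vec.span {v}" "bilin u u = 0" "bilin u v = 0" "bilin v v = 0"
    "\<And>b. b \<in> B \<Longrightarrow> \<exists>c d. b *v u = c *s u + d *s v"
    "\<And>b. b \<in> B \<Longrightarrow> \<exists>c. b *v v = c *s v"
proof -
  obtain v where v: "v \<noteq> 0" "bilin v v = 0" "\<forall>b\<in>B. \<exists>c. b *v v = c *s v"
    using isotropic_extension[OF n Bo, of 0] by auto
  obtain u where "u \<notin> vec.span {v}" "bilin v u = 0" "bilin u u = 0"
    "\<forall>b\<in>B. \<exists>c d. b *v u = c *s u + d *s v"
    using isotropic_extension[OF n Bo v(2)] v by blast
  with v that show ?thesis
    by (metis bilin_commute)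
qed

lemma jacobi:
  "lie_bracket (lie_bracket X Y) Z =
    lie_bracket X (lie_bracket Y Z) - lie_bracket Y (lie_bracket X Z)"
  by (subst matrix_eq) (simp add: lie_bracket_mult_vec matrix_vector_mult_diff_rdistrib
      matrix_vector_mult_diff_distrib)

text \<open>Two dual pairs of vectors that span complementary isotropic planes. The elements \<open>x\<close>, \<open>h\<close>, \<open>y\<close>
  below form an \<open>sl\<^sub>2\<close>-triple.\<close>

locale hyperbolic =
  fixes u v p q :: "complex ^ 'n::finite"
  assumes hyp: "bilin u u = 0" "bilin u v = 0" "bilin v v = 0"
    "bilin p p = 0" "bilin p q = 0" "bilin q q = 0"
    "bilin u p = 1" "bilin u q = 0" "bilin v p = 0" "bilin v q = 1"
begin

definition "x = wedge u v"
definition "y = wedge q p"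
definition "h = wedge u p + wedge v q"

lemma in_so: "x \<in> so" "y \<in> so" "h \<in> so"
  by (auto simp: x_def y_def h_def wedge_in_so gl.subspace_add[OF so_subspace])

lemma bilin_dual [simp]: "bilin v u = 0" "bilin q p = 0" "bilin p u = 1" "bilin q u = 0" "bilin p v = 0" "bilin q v = 1"
  using hyp by (metis bilin_commute)+

lemma x_mult: "x *v w = bilin v w *s u - bilin u w *s v"
  by (simp add: x_def wedge_mult_vec)

lemma h_mult: "h *v w = bilin p w *s u - bilin u w *s p + bilin q w *s v - bilin v w *s q"
  by (simp add: h_def wedge_mult_vec matrix_vector_mult_add_rdistrib)

lemma h_eigen: "h *v u = u" "h *v v = v" "h *v p = - p" "h *v q = - q"
  by (simp_all add: h_mult hyp)

lemma sl2: "lie_bracket x y = h" "lie_bracket h x = mscale 2 x" "lie_bracket h y = mscale (- 2) y"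
proof -
  show "lie_bracket x y = h"
    by (simp add: y_def lie_bracket_wedge[OF in_so(1)] x_mult hyp wedge_simps h_def wedge_swap[of q v])
  have "mscale 2 A = A + A" "mscale (- 2) A = - A - A" for A :: "'n cmat"
    by (simp_all add: vec_eq_iff mscale_component)
  then show "lie_bracket h x = mscale 2 x" "lie_bracket h y = mscale (- 2) y"
    by (simp_all add: x_def y_def lie_bracket_wedge[OF in_so(3)] h_eigen wedge_simps)
qed

end

text \<open>A dual family exists as the form is nondegenerate. Subtracting suitable multiples of \<open>u\<close> and \<open>v\<close>
  makes it isotropic.\<close>

lemma hyperbolic_completion:
  fixes u v :: "complex ^ 'n::finite"
  assumes "v \<noteq> 0" "u \<notin> vec.span {v}" "bilin u u = 0" "bilin u v = 0" "bilin v v = 0"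
  obtains p q where "hyperbolic u v p q"
proof -
  have ex: "\<exists>r. bilin s r = 1 \<and> bilin t r = 0" if st: "t \<noteq> 0" "s \<notin> vec.span {t}" for s t :: "complex ^ 'n"
  proof -
    obtain e where e: "bilin t e = 1"
      using bilin_eq_1_exists[OF st(1)] by blast
    have "s - bilin s e *s t \<noteq> 0"
      using st(2) by (auto simp: vec.span_singleton)
    then obtain f where f: "bilin (s - bilin s e *s t) f = 1"
      using bilin_eq_1_exists by blast
    have "bilin s (f - bilin t f *s e) = 1 \<and> bilin t (f - bilin t f *s e) = 0"
      using f e by (simp add: mult.commute)
    then show ?thesis by blast
  qed
  have "u \<noteq> 0"
    using assms(2) vec.span_zero by metis
  moreover have "v \<notin> vec.span {u}"
  proof
    assume "v \<in> vec.span {u}"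
    then obtain c where "v = c *s u"
      by (auto simp: vec.span_singleton)
    with assms(1) have "c \<noteq> 0" "u = inverse c *s v"
      by auto
    then show False
      using assms(2) by (auto simp: vec.span_singleton)
  qed
  ultimately obtain p0 q0 where pq: "bilin u p0 = 1" "bilin v p0 = 0" "bilin v q0 = 1" "bilin u q0 = 0"
    using ex[OF assms(1,2)] ex[of u v] by blast
  define p where "p = p0 - (bilin p0 p0 / 2) *s u"
  define r where "r = q0 - bilin q0 p *s u"
  define q where "q = r - (bilin r r / 2) *s v"
  have com: "bilin v u = 0" "bilin p0 u = 1" "bilin p0 v = 0" "bilin q0 v = 1" "bilin q0 u = 0"
    using pq assms by (simp_all add: bilin_commute)
  have p: "bilin p p = 0" "bilin u p = 1" "bilin v p = 0" "bilin p u = 1" "bilin p v = 0"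
    using pq assms com by (simp_all add: p_def)
  have r: "bilin r p = 0" "bilin p r = 0" "bilin u r = 0" "bilin v r = 1" "bilin r v = 1"
    using pq assms com p bilin_commute[of p q0] by (simp_all add: r_def)
  have "hyperbolic u v p q"
    by standard (use assms p r pq com in \<open>simp_all add: q_def\<close>)
  then show ?thesis by (rule that)
qed


section \<open>The highest weight of the adjoint representation\<close>

context hyperbolic
begin

lemma decompose:
  obtains w0 where "w = bilin p w *s u + bilin q w *s v + bilin u w *s p + bilin v w *s q + w0"
    "bilin u w0 = 0" "bilin v w0 = 0" "bilin p w0 = 0" "bilin q w0 = 0"
proof -
  let ?w = "w - (bilin p w *s u + bilin q w *s v + bilin u w *s p + bilin v w *s q)"
  have "bilin u ?w = 0" "bilin v ?w = 0" "bilin p ?w = 0" "bilin q ?w = 0"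
    by (simp_all add: hyp)
  then show ?thesis
    by (intro that[of ?w]) auto
qed

text \<open>The orthogonal complement of the hyperbolic 4-space is nondegenerate, and nonzero as \<open>n\<close> is at
  least 5.\<close>

lemma exists_anisotropic:
  assumes n: "CARD('n) \<ge> 5"
  obtains f where "bilin u f = 0" "bilin v f = 0" "bilin p f = 0" "bilin q f = 0" "bilin f f \<noteq> 0"
proof -
  let ?V = "{f. bilin u f = 0 \<and> bilin v f = 0 \<and> bilin p f = 0 \<and> bilin q f = 0}"
  have "card {u, v, p, q} \<le> 4"
    using card_length[of "[u, v, p, q]"] by simp
  then obtain f where f: "f \<noteq> 0" "f \<in> ?V"
    using exists_orthogonal_vector[of "{u, v, p, q}"] n by auto
  have "\<exists>f\<in>?V. bilin f f \<noteq> 0"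
  proof (rule ccontr)
    assume "\<not> (\<exists>f\<in>?V. bilin f f \<noteq> 0)"
    then have iso: "bilin g g = 0" if "g \<in> ?V" for g
      using that by blast
    have "bilin f w = 0" for w
    proof -
      obtain w0 where w0: "w = bilin p w *s u + bilin q w *s v + bilin u w *s p + bilin v w *s q + w0"
        "w0 \<in> ?V"
        using decompose[of w] by blast
      have "bilin (f + w0) (f + w0) = 0"
        using f w0(2) by (intro iso) simp
      then have "bilin f w0 = 0"
        using iso[of f] iso[of w0] f w0(2) bilin_commute[of f w0] by simp
      moreover have "bilin f u = 0" "bilin f v = 0" "bilin f p = 0" "bilin f q = 0"
        using f(2) by (simp_all add: bilin_commute[of f])
      ultimately show ?thesis
        by (subst w0(1)) simp
    qed
    then show False
      using bilin_nondegenerate[of f] f(1) by blast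
  qed
  then show ?thesis using that by blast
qed

text \<open>The elements \<open>wedge t f\<close>, with \<open>t\<close> in the plane of \<open>u\<close> and \<open>v\<close> and \<open>f\<close> orthogonal to that plane, form
  the nilradical \<open>N\<close> of the stabiliser of the plane. It is a Heisenberg algebra with centre spanned by
  \<open>x\<close>, so it is solvable, and \<open>B\<close> absorbs it. The element \<open>h\<close> is central in the stabiliser modulo \<open>N\<close>,
  so it normalises \<open>B\<close>.\<close>

lemma borel_contains_nilradical:
  assumes Bo: "borel_subalgebra so B"
    and Bu: "\<And>b. b \<in> B \<Longrightarrow> \<exists>c d. b *v u = c *s u + d *s v"
    and Bv: "\<And>b. b \<in> B \<Longrightarrow> \<exists>c d. b *v v = c *s u + d *s v"
  shows "x \<in> B" "h \<in> B" "bilin u f = 0 \<Longrightarrow> bilin v f = 0 \<Longrightarrow> wedge u f \<in> B \<and> wedge v f \<in> B"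
proof -
  have B: "B \<subseteq> so"
    using Bo by (auto simp: borel_subalgebra_def)
  define V where "V = {f. bilin u f = 0 \<and> bilin v f = 0}"
  define N where "N = {wedge u f + wedge v g | f g. f \<in> V \<and> g \<in> V}"
  have N_I: "wedge u f + wedge v g \<in> N" if "f \<in> V" "g \<in> V" for f g
    using that by (auto simp: N_def)
  have zero: "0 \<in> V" and uV: "u \<in> V" and vV: "v \<in> V"
    by (simp_all add: V_def hyp)
  have sV: "c *s f + d *s g \<in> V" if "f \<in> V" "g \<in> V" for c d f g
    using that by (simp add: V_def)
  have N_so: "N \<subseteq> so"
    by (auto simp: N_def wedge_in_so intro!: gl.subspace_add[OF so_subspace])
  have sub: "gl.subspace N"
    unfolding gl.subspace_def
  proof (intro conjI allI ballI)
    show "0 \<in> N"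
      using N_I[OF zero zero] by (simp add: wedge_simps)
  next
    fix a b assume "a \<in> N" "b \<in> N"
    then obtain f g f' g' where *: "a = wedge u f + wedge v g" "b = wedge u f' + wedge v g'"
      "f \<in> V" "g \<in> V" "f' \<in> V" "g' \<in> V"
      unfolding N_def by blast
    have "a + b = wedge u (1 *s f + 1 *s f') + wedge v (1 *s g + 1 *s g')"
      by (simp add: * wedge_simps)
    also have "\<dots> \<in> N"
      using * by (intro N_I sV)
    finally show "a + b \<in> N" .
  next
    fix c a assume "a \<in> N"
    then obtain f g where *: "a = wedge u f + wedge v g" "f \<in> V" "g \<in> V"
      unfolding N_def by blast
    have "mscale c a = wedge u (c *s f + 0 *s f) + wedge v (c *s g + 0 *s g)"
      by (simp add: * wedge_simps gl.scale_right_distrib)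
    also have "\<dots> \<in> N"
      using * by (intro N_I sV)
    finally show "mscale c a \<in> N" .
  qed
  have bracket: "\<exists>c. lie_bracket a b = mscale c x" if ab: "a \<in> N" "b \<in> N" for a b
  proof -
    obtain f g where 1: "a = wedge u f + wedge v g" "f \<in> V" "g \<in> V"
      using ab(1) unfolding N_def by blast
    obtain f' g' where 2: "b = wedge u f' + wedge v g'" "f' \<in> V" "g' \<in> V"
      using ab(2) unfolding N_def by blast
    have com: "bilin f u = 0" "bilin f v = 0" "bilin g u = 0" "bilin g v = 0"
      using 1 by (auto simp: V_def bilin_commute[of f] bilin_commute[of g])
    have act: "a *v w = bilin f w *s u - bilin u w *s f + bilin g w *s v - bilin v w *s g" for w
      by (simp add: 1 wedge_mult_vec matrix_vector_mult_add_rdistrib)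
    have "a *v u = 0" "a *v v = 0" "a *v f' = bilin f f' *s u + bilin g f' *s v"
      "a *v g' = bilin f g' *s u + bilin g g' *s v"
      using 2 com by (simp_all add: act hyp V_def)
    then have "lie_bracket a b = mscale (bilin g f' - bilin f g') x"
      using ab N_so
      by (simp add: 2 lie_bracket_linear lie_bracket_wedge subsetD wedge_simps x_def
          wedge_swap[of v u] mscale_uminus gl.scale_left_diff_distrib)
    then show ?thesis by blast
  qed
  have xN: "x \<in> N"
    using N_I[OF vV zero] by (simp add: x_def wedge_simps)
  have lieN: "lie_subalgebra N"
    using bracket gl.subspace_scale[OF sub xN] by (force simp: lie_subalgebra_def sub)
  have "lie_bracket a b = 0" if "a \<in> gl.span {x}" "b \<in> gl.span {x}" for a b
    using that by (auto simp: gl.span_singleton lie_bracket_linear lie_bracket_self)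
  then have "solvable_lie (gl.span {x})"
    using abelian_lie_subalgebra[OF gl.subspace_span] by blast
  moreover have "(derived_algebra ^^ 1) N \<subseteq> gl.span {x}"
    using bracket unfolding funpow.simps(2) One_nat_def funpow.simps(1) comp_def id_apply derived_algebra_def
    by (intro gl.span_minimal) (force simp: gl.span_singleton)+
  ultimately have solvN: "solvable_lie N"
    using solvable_if_derived_power[OF sub] by blast
  have NB: "N \<subseteq> B"
  proof (rule borel_absorbs_solvable_normalised[OF Bo lieN solvN N_so])
    fix b m assume b: "b \<in> B" and m: "m \<in> N"
    obtain f g where fg: "m = wedge u f + wedge v g" "f \<in> V" "g \<in> V"
      using m unfolding N_def by blast
    have bso: "b \<in> so" using b B by blast
    obtain c d where bu: "b *v u = c *s u + d *s v" using Bu[OF b] by blast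
    obtain c' d' where bv: "b *v v = c' *s u + d' *s v" using Bv[OF b] by blast
    have bV: "b *v f \<in> V" if "f \<in> V" for f
      using that bilin_skew[OF bso, of u f] bilin_skew[OF bso, of v f]
      by (simp add: bu bv V_def)
    have "lie_bracket b m = wedge u (1 *s (c *s f + c' *s g) + 1 *s (b *v f)) +
        wedge v (1 *s (d *s f + d' *s g) + 1 *s (b *v g))"
      by (simp add: fg lie_bracket_linear lie_bracket_wedge[OF bso] bu bv wedge_simps)
    also have "\<dots> \<in> N"
      using fg by (intro N_I sV bV)
    finally show "lie_bracket b m \<in> N" .
  qed
  show "x \<in> B"
    using xN NB by blast
  show "wedge u f \<in> B \<and> wedge v f \<in> B" if "bilin u f = 0" "bilin v f = 0"
  proof -
    have "f \<in> V" using that by (simp add: V_def)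
    then have "wedge u f + wedge v 0 \<in> N" "wedge u 0 + wedge v f \<in> N"
      using zero by (auto intro!: N_I)
    then show ?thesis
      using NB by (auto simp: wedge_simps)
  qed
  show "h \<in> B"
  proof (rule borel_absorbs_normaliser[OF Bo in_so(3)])
    fix b assume b: "b \<in> B"
    have bso: "b \<in> so" using b B by blast
    obtain c d where bu: "b *v u = c *s u + d *s v" using Bu[OF b] by blast
    obtain c' d' where bv: "b *v v = c' *s u + d' *s v" using Bv[OF b] by blast
    have eq: "bilin u (b *v w) = - (c * bilin u w + d * bilin v w)"
         "bilin v (b *v w) = - (c' * bilin u w + d' * bilin v w)" for w
      using bilin_skew[OF bso, of u w] bilin_skew[OF bso, of v w] by (simp_all add: bu bv)
    have "lie_bracket b h = wedge u (c *s p + c' *s q + b *v p) + wedge v (d *s p + d' *s q + b *v q)"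
      by (simp add: h_def lie_bracket_linear lie_bracket_wedge[OF bso] bu bv wedge_simps)
    also have "\<dots> \<in> N"
      by (intro N_I) (simp_all add: V_def eq hyp)
    finally show "lie_bracket b h \<in> B"
      using NB by blast
  qed
qed

text \<open>A \<open>B\<close>-eigenvector \<open>z\<close> in \<open>so\<close> commutes with the nilradical, because an element \<open>m\<close> with \<open>[h, m] = m\<close>
  acts on the line of \<open>z\<close> as a commutator of scalars. Commuting with all \<open>wedge u f\<close> and \<open>wedge v f\<close>
  forces \<open>z\<close> to vanish on \<open>u\<close>, \<open>v\<close> and on the complement of the hyperbolic 4-space, and to map \<open>p\<close> and
  \<open>q\<close> into the plane of \<open>u\<close> and \<open>v\<close>. There \<open>h\<close> acts by 1, while it acts by -1 on \<open>p\<close> and \<open>q\<close>. So the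
  weight of \<open>z\<close> is 2.\<close>

lemma highest_weight_on_h:
  assumes n: "CARD('n) \<ge> 5" and Bo: "borel_subalgebra so B"
    and Bu: "\<And>b. b \<in> B \<Longrightarrow> \<exists>c d. b *v u = c *s u + d *s v"
    and Bv: "\<And>b. b \<in> B \<Longrightarrow> \<exists>c d. b *v v = c *s u + d *s v"
    and z: "z \<in> so" "z \<noteq> 0" and th: "\<And>b. b \<in> B \<Longrightarrow> lie_bracket b z = mscale (th b) z"
  shows "th h = 2"
proof -
  note inB = borel_contains_nilradical[OF Bo Bu Bv]
  let ?V = "{f. bilin u f = 0 \<and> bilin v f = 0 \<and> bilin p f = 0 \<and> bilin q f = 0}"
  have commutes: "lie_bracket m z = 0" if m: "m \<in> B" "lie_bracket h m = m" for m
  proof -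
    have "lie_bracket (lie_bracket h m) z =
        lie_bracket h (lie_bracket m z) - lie_bracket m (lie_bracket h z)"
      by (rule jacobi)
    also have "\<dots> = 0"
      using th m(1) inB(2) by (simp add: lie_bracket_linear mult.commute)
    finally show ?thesis
      using m(2) by simp
  qed
  have skew: "bilin (z *v a) b = - bilin a (z *v b)" for a b
    by (rule bilin_skew[OF z(1)])
  have wedge0: "wedge (z *v t) f + wedge t (z *v f) = 0" if t: "t = u \<or> t = v" and f: "f \<in> ?V" for t f
  proof -
    have "h *v f = 0" "h *v t = t"
      using f t by (auto simp: h_mult hyp)
    then have "lie_bracket h (wedge t f) = wedge t f"
      by (simp add: lie_bracket_wedge[OF in_so(3)] wedge_simps)
    then have "lie_bracket (wedge t f) z = 0"
      using t f inB(3)[of f] by (intro commutes) auto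
    then have "lie_bracket z (wedge t f) = 0"
      using lie_bracket_swap[of z "wedge t f"] by simp
    then show ?thesis
      by (simp add: lie_bracket_wedge[OF z(1)])
  qed
  have E: "bilin f w *s (z *v t) - bilin (z *v t) w *s f + bilin (z *v f) w *s t - bilin t w *s (z *v f) = 0"
    if t: "t = u \<or> t = v" and f: "f \<in> ?V" for t f w
    using arg_cong[OF wedge0[OF t f], of "\<lambda>M. M *v w"]
    by (simp add: matrix_vector_mult_add_rdistrib wedge_mult_vec add_diff_eq)
  have fcom: "bilin f u = 0" "bilin f v = 0" "bilin f p = 0" "bilin f q = 0" if "f \<in> ?V" for f
    using that by (simp_all add: bilin_commute[of f])
  have zf: "z *v f = - bilin (z *v u) p *s f" if f: "f \<in> ?V" for f
  proof -
    have 1: "z *v f = bilin (z *v f) p *s u - bilin (z *v u) p *s f"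
      using E[of u f p] f fcom[OF f] by (simp add: hyp)
    have 2: "z *v f = bilin (z *v f) q *s v - bilin (z *v v) q *s f"
      using E[of v f q] f fcom[OF f] by (simp add: hyp)
    have "bilin (z *v f) p = bilin (bilin (z *v f) q *s v - bilin (z *v v) q *s f) p"
      using 2 by metis
    then have "bilin (z *v f) p = 0"
      using fcom[OF f] by (simp add: hyp)
    with 1 show ?thesis by (simp add: vec.scale_minus_left)
  qed
  obtain f where f: "f \<in> ?V" "bilin f f \<noteq> 0"
    using exists_anisotropic[OF n] by blast
  have "bilin (z *v f) f = 0"
    by (rule bilin_skew_self[OF z(1)])
  then have "bilin (z *v u) p = 0"
    using zf[OF f(1)] f(2) by simp
  then have zV: "z *v g = 0" if "g \<in> ?V" for g
    using zf[OF that] by simp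
  have zt: "z *v t = 0" if t: "t = u \<or> t = v" for t
  proof -
    have "bilin t f = 0" "bilin (z *v t) f = 0"
      using t f zV[OF f(1)] by (auto simp: skew)
    then have "bilin f f *s (z *v t) = 0"
      using E[OF t f(1), of f] zV[OF f(1)] by simp
    then show ?thesis
      using f(2) by simp
  qed
  have hz: "h *v (z *v w) = z *v w" if w: "w = p \<or> w = q" for w
  proof -
    let ?r = "z *v w - (bilin p (z *v w) *s u + bilin q (z *v w) *s v)"
    have orth: "bilin u (z *v w) = 0" "bilin v (z *v w) = 0" "\<And>g. g \<in> ?V \<Longrightarrow> bilin (z *v w) g = 0"
      using zt[of u] zt[of v] zV skew[of u w] skew[of v w] skew[of w] by auto
    then have orth': "bilin (z *v w) u = 0" "bilin (z *v w) v = 0"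
      by (simp_all add: bilin_commute[of "z *v w"])
    have "bilin ?r a = 0" for a
    proof -
      obtain a0 where a0: "a = bilin p a *s u + bilin q a *s v + bilin u a *s p + bilin v a *s q + a0"
        "a0 \<in> ?V"
        using decompose[of a] by blast
      show ?thesis
        using a0(2) orth(3)[OF a0(2)]
        by (subst a0(1)) (simp add: hyp orth' bilin_commute[of "z *v w" p] bilin_commute[of "z *v w" q])
    qed
    then have "?r = 0"
      by (rule bilin_nondegenerate)
    then have "z *v w = bilin p (z *v w) *s u + bilin q (z *v w) *s v"
      by simp
    then show ?thesis
      by (metis h_eigen(1,2) matrix_vector_right_distrib vector_scalar_commute)
  qed
  have "z *v p \<noteq> 0 \<or> z *v q \<noteq> 0"
  proof (rule ccontr)
    assume neg: "\<not> (z *v p \<noteq> 0 \<or> z *v q \<noteq> 0)"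
    have "z *v w = 0" for w
    proof -
      obtain w0 where w0: "w = bilin p w *s u + bilin q w *s v + bilin u w *s p + bilin v w *s q + w0"
        "w0 \<in> ?V"
        using decompose[of w] by blast
      show ?thesis
        using neg zt zV[OF w0(2)]
        by (subst w0(1)) (simp add: matrix_vector_right_distrib vector_scalar_commute)
    qed
    then show False
      using z(2) by (simp add: matrix_eq)
  qed
  then obtain w where w: "w = p \<or> w = q" "z *v w \<noteq> 0"
    by blast
  have "h *v w = - w"
    using w(1) h_eigen by auto
  then have "lie_bracket h z *v w = z *v w + z *v w"
    using hz[OF w(1)] by (simp add: lie_bracket_mult_vec vec.linear_neg[OF matrix_vector_mul_linear_gen])
  moreover have "lie_bracket h z *v w = th h *s (z *v w)"
    using th[OF inB(2)] by (simp add: mscale_mult_vec)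
  ultimately have "(th h - 2) *s (z *v w) = 0"
    by (simp add: vec_eq_iff algebra_simps)
  then show ?thesis
    using w(2) by simp
qed

end


section \<open>The tensor square and the kernel of the projection\<close>

lemma iota_0: "iota 0 = 0"
  by (simp add: iota_def)

lemma iota_minus: "iota (- X) = - iota X"
  using iota_add[of X "- X"] by (simp add: iota_0 eq_neg_iff_add_eq_0 add.commute)

lemma iota_diff: "iota (X - Y) = iota X - iota Y"
  using iota_add[of X "- Y"] by (simp add: iota_minus)

lemma iota_sum: "iota (sum f I) = (\<Sum>i\<in>I. iota (f i))"
  by (induction I rule: infinite_finite_induct) (simp_all add: iota_0 iota_add)

lemma lookup_iota: "Poly_Mapping.lookup (iota X) [(k, l)] = X $ k $ l"
proof -
  have "Poly_Mapping.lookup (iota X) [(k, l)] =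
      (\<Sum>i\<in>UNIV. \<Sum>j\<in>UNIV. if i = k then (if j = l then X $ i $ j else 0) else 0)"
    by (auto simp: iota_def lookup_sum lookup_single when_def intro!: sum.cong)
  also have "\<dots> = X $ k $ l"
    by (subst sum.swap) simp
  finally show ?thesis .
qed

lemma iota_inject: "iota X = iota Y \<longleftrightarrow> X = Y"
  by (metis lookup_iota vec_eq_iff)

lemma tscale_mult_tscale: "tscale a s * tscale b t = tscale (a * b) (s * t)"
  by (simp add: tscale_mult_left tscale_mult_right)

lemma tensor_act_tscale: "tensor_act X (tscale c t) = tscale c (tensor_act X t)"
proof -
  have "tensor_act X (scalar c) = 0"
    by (simp add: scalar_def tensor_act_single)
  then show ?thesis
    by (simp add: tscale_def tensor_act_mult)
qed

lemma tensor_act_0: "tensor_act X 0 = 0"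
  using tensor_act_tscale[of X 0 0] by simp

lemma tensor_power_1: "tensor_power so 1 = iota ` (so :: 'n::finite cmat set)"
proof -
  let ?so = "so :: 'n cmat set"
  have "{prod_list (map iota Xs) | Xs. set Xs \<subseteq> ?so \<and> length Xs = 1} = iota ` ?so"
    by (force simp: length_Suc_conv)
  then have "tensor_power ?so 1 = tens.span (iota ` ?so)"
    unfolding tensor_power_def by (rule arg_cong)
  moreover have "tens.subspace (iota ` ?so)"
    unfolding tens.subspace_def
    using so_subspace
    by (auto simp: gl.subspace_def simp flip: iota_0 iota_add iota_mscale)
  ultimately show ?thesis
    by (metis tens.span_eq_iff)
qed

lemma tensor_power_2: "tensor_power L 2 = tens.span {iota X * iota Y | X Y. X \<in> L \<and> Y \<in> L}"
proof -
  have "{prod_list (map iota Xs) | Xs. set Xs \<subseteq> L \<and> length Xs = 2} =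
      {iota X * iota Y | X Y. X \<in> L \<and> Y \<in> L}"
  proof (intro equalityI subsetI)
    fix t assume "t \<in> {prod_list (map iota Xs) | Xs. set Xs \<subseteq> L \<and> length Xs = 2}"
    then obtain Xs where Xs: "t = prod_list (map iota Xs)" "set Xs \<subseteq> L" "length Xs = 2"
      by blast
    then obtain X Y where "Xs = [X, Y]"
      by (auto simp: numeral_2_eq_2 length_Suc_conv)
    with Xs show "t \<in> {iota X * iota Y | X Y. X \<in> L \<and> Y \<in> L}"
      by auto
  next
    fix t assume "t \<in> {iota X * iota Y | X Y. X \<in> L \<and> Y \<in> L}"
    then obtain X Y where "t = iota X * iota Y" "X \<in> L" "Y \<in> L" by blast
    then show "t \<in> {prod_list (map iota Xs) | Xs. set Xs \<subseteq> L \<and> length Xs = 2}"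
      by (intro CollectI exI[of _ "[X, Y]"]) simp
  qed
  then show ?thesis
    by (simp add: tensor_power_def)
qed

lemma tensor_power_2_subspace: "tens.subspace (tensor_power L 2)"
  by (simp add: tensor_power_2)

lemma iota_mult_in_tensor_power_2: "X \<in> L \<Longrightarrow> Y \<in> L \<Longrightarrow> iota X * iota Y \<in> tensor_power L 2"
  unfolding tensor_power_2 by (intro tens.span_base) blast

lemma tensor_power_2_induct [consumes 1, case_names zero add scale mult]:
  assumes "t \<in> tensor_power L 2"
    and "P 0" "\<And>s t. P s \<Longrightarrow> P t \<Longrightarrow> P (s + t)" "\<And>c t. P t \<Longrightarrow> P (tscale c t)"
    and "\<And>X Y. X \<in> L \<Longrightarrow> Y \<in> L \<Longrightarrow> P (iota X * iota Y)"
  shows "P t"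
  using assms(1) unfolding tensor_power_2
proof (induction rule: tens.span_induct_alt)
  case base
  show ?case by (rule assms)
next
  case (step c x y)
  then show ?case using assms by blast
qed

lemma tensor_act_closed:
  assumes "X \<in> so" "t \<in> tensor_power so 2"
  shows "tensor_act X t \<in> tensor_power so 2"
  using assms(2)
proof (induction rule: tensor_power_2_induct)
  case (mult Y Z)
  then show ?case
    using assms(1) by (simp add: tensor_act_mult tensor_act_iota iota_mult_in_tensor_power_2 so_bracket
        tens.subspace_add[OF tensor_power_2_subspace])
qed (simp_all add: tensor_act_0 tensor_act_add tensor_act_tscale
    tens.subspace_0[OF tensor_power_2_subspace] tens.subspace_add[OF tensor_power_2_subspace]
    tens.subspace_scale[OF tensor_power_2_subspace])

lemma tensor_act_bracket:
  assumes "t \<in> tensor_power L 2"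
  shows "tensor_act X (tensor_act Y t) = tensor_act Y (tensor_act X t) + tensor_act (lie_bracket X Y) t"
  using assms
proof (induction rule: tensor_power_2_induct)
  case (mult A B)
  show ?case
    by (simp add: tensor_act_mult tensor_act_iota tensor_act_add jacobi iota_diff algebra_simps)
qed (simp_all add: tensor_act_0 tensor_act_add tensor_act_tscale tens.scale_right_distrib)

lemma tensor_act_mscale:
  assumes "t \<in> tensor_power L 2"
  shows "tensor_act (mscale c X) t = tscale c (tensor_act X t)"
  using assms
proof (induction rule: tensor_power_2_induct)
  case (mult A B)
  show ?case
    by (simp add: tensor_act_mult tensor_act_iota lie_bracket_linear iota_mscale
        tscale_mult_left tscale_mult_right tens.scale_right_distrib)
qed (simp_all add: tensor_act_0 tensor_act_add tensor_act_tscale tens.scale_right_distrib mult.commute)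

lemma tensor_act_power_linear:
  "(tensor_act X ^^ k) (s + t) = (tensor_act X ^^ k) s + (tensor_act X ^^ k) t"
  "(tensor_act X ^^ k) (tscale c t) = tscale c ((tensor_act X ^^ k) t)"
  "(tensor_act X ^^ k) 0 = 0"
  by (induction k) (simp_all add: tensor_act_add tensor_act_tscale tensor_act_0)

text \<open>For two standard basis vectors \<open>e\<^sub>a\<close> and \<open>e\<^sub>d\<close>, this is the tensor
  \<open>\<Sum>\<^sub>b F\<^sub>a\<^sub>b \<otimes> F\<^sub>b\<^sub>d\<close>. As tensors with four indices, they are products of the metric and a tensor
  with two indices, made skew in both index pairs: the pure traces in the square of \<open>so\<close>.\<close>

definition kappa :: "complex ^ 'n::finite \<Rightarrow> complex ^ 'n \<Rightarrow> 'n tensor" where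
  "kappa a d = (\<Sum>b\<in>UNIV. iota (wedge a (axis b 1)) * iota (wedge (axis b 1) d))"

text \<open>Up to a tensor that changes sign when the two factors are exchanged, this is a multiple of the
  totally skew tensor \<open>a \<and> b \<and> c \<and> d\<close>.\<close>

definition omega :: "complex ^ 'n::finite \<Rightarrow> complex ^ 'n \<Rightarrow> complex ^ 'n \<Rightarrow> complex ^ 'n \<Rightarrow> 'n tensor" where
  "omega a b c d = iota (wedge a b) * iota (wedge c d) + iota (wedge a c) * iota (wedge d b) +
     iota (wedge a d) * iota (wedge b c)"

text \<open>The Cartan square of \<open>so\<close> consists of the tensors with the symmetries of a Weyl curvature
  tensor. The tensors below have no component of this type.\<close>

definition non_weyl :: "'n::finite tensor set" where
  "non_weyl = tens.span ({kappa a d | a d. True} \<union> {omega a b c d | a b c d. True})"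

lemma kappa_in_non_weyl: "kappa a d \<in> non_weyl" and omega_in_non_weyl: "omega a b c d \<in> non_weyl"
  unfolding non_weyl_def by (intro tens.span_base; blast)+

lemma non_weyl_subspace: "tens.subspace non_weyl"
  by (simp add: non_weyl_def)

lemma non_weyl_induct [consumes 1, case_names zero add scale kappa omega]:
  assumes "t \<in> non_weyl"
    and "P 0" "\<And>s t. P s \<Longrightarrow> P t \<Longrightarrow> P (s + t)" "\<And>c t. P t \<Longrightarrow> P (tscale c t)"
    and "\<And>a d. P (kappa a d)" "\<And>a b c d. P (omega a b c d)"
  shows "P t"
  using assms(1) unfolding non_weyl_def
proof (induction rule: tens.span_induct_alt)
  case base
  show ?case by (rule assms)
next
  case (step c x y)
  then show ?case using assms by blast
qed

lemma kappa_in_tensor_power: "kappa a d \<in> tensor_power so 2"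
  unfolding kappa_def
  by (intro tens.subspace_sum[OF tensor_power_2_subspace] iota_mult_in_tensor_power_2 wedge_in_so)

lemma omega_in_tensor_power: "omega a b c d \<in> tensor_power so 2"
  unfolding omega_def
  by (intro tens.subspace_add[OF tensor_power_2_subspace] iota_mult_in_tensor_power_2 wedge_in_so)

lemma non_weyl_subset: "non_weyl \<subseteq> tensor_power so 2"
  unfolding non_weyl_def
  by (intro tens.span_minimal tensor_power_2_subspace) (auto simp: kappa_in_tensor_power omega_in_tensor_power)

lemma matrix_axis_expand: "X *v axis b 1 = (\<Sum>c\<in>UNIV. X $ c $ b *s axis c 1)"
proof -
  have "(X *v axis b 1) $ i = (\<Sum>c\<in>UNIV. X $ c $ b *s axis c 1) $ i" for i
  proof -
    have "X $ c $ b * axis c 1 $ i = (if i = c then X $ c $ b else 0)" for c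
      by (simp add: axis_def)
    then have "(\<Sum>c\<in>UNIV. X $ c $ b *s axis c 1) $ i = (\<Sum>c\<in>UNIV. if i = c then X $ c $ b else 0)"
      by simp
    moreover have "X $ i $ j * axis b 1 $ j = (if j = b then X $ i $ j else 0)" for j
      by (simp add: axis_def)
    then have "(X *v axis b 1) $ i = (\<Sum>j\<in>UNIV. if j = b then X $ i $ j else 0)"
      by (simp add: matrix_vector_mult_def)
    ultimately show ?thesis by simp
  qed
  then show ?thesis by (simp add: vec_eq_iff)
qed

lemma wedge_sum: "wedge a (sum f I) = (\<Sum>i\<in>I. wedge a (f i))" "wedge (sum f I) a = (\<Sum>i\<in>I. wedge (f i) a)"
  by (induction I rule: infinite_finite_induct) (simp_all add: wedge_simps)

text \<open>The terms in which \<open>X\<close> hits the summation index cancel, as \<open>X\<close> is skew.\<close>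

lemma tensor_act_kappa:
  assumes X: "X \<in> so"
  shows "tensor_act X (kappa a d) = kappa (X *v a) d + kappa a (X *v d)"
proof -
  let ?e = "\<lambda>b. axis b 1 :: complex ^ 'a"
  let ?g = "\<lambda>c b. iota (wedge a (?e c)) * iota (wedge (?e b) d)"
  have "(\<Sum>b\<in>UNIV. iota (wedge a (X *v ?e b)) * iota (wedge (?e b) d)) =
      (\<Sum>b\<in>UNIV. \<Sum>c\<in>UNIV. tscale (X $ c $ b) (?g c b))"
    by (simp add: matrix_axis_expand wedge_sum wedge_simps iota_sum iota_mscale
        sum_distrib_right tscale_mult_left)
  also have "\<dots> = (\<Sum>c\<in>UNIV. \<Sum>b\<in>UNIV. tscale (X $ c $ b) (?g c b))"
    by (rule sum.swap)
  also have "\<dots> = (\<Sum>c\<in>UNIV. \<Sum>b\<in>UNIV. - tscale (X $ b $ c) (?g c b))"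
    by (intro sum.cong refl) (subst so_component[OF X], simp)
  also have "\<dots> = - (\<Sum>b\<in>UNIV. iota (wedge a (?e b)) * iota (wedge (X *v ?e b) d))"
    by (simp add: matrix_axis_expand wedge_sum wedge_simps iota_sum iota_mscale
        sum_distrib_left tscale_mult_right sum_negf)
  finally have "(\<Sum>b\<in>UNIV. iota (wedge a (X *v ?e b)) * iota (wedge (?e b) d)) +
      (\<Sum>b\<in>UNIV. iota (wedge a (?e b)) * iota (wedge (X *v ?e b) d)) = 0"
    by simp
  then show ?thesis
    by (simp add: kappa_def tensor_act_sum tensor_act_mult tensor_act_iota lie_bracket_wedge[OF X]
        iota_add ring_distribs sum.distrib add.assoc)
qed

lemma tensor_act_omega:
  assumes X: "X \<in> so"
  shows "tensor_act X (omega a b c d) = omega (X *v a) b c d + omega a (X *v b) c d +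
    omega a b (X *v c) d + omega a b c (X *v d)"
  by (simp add: omega_def tensor_act_add tensor_act_mult tensor_act_iota lie_bracket_wedge[OF X]
      iota_add algebra_simps)

lemma non_weyl_submodule: "submodule_of so (non_weyl :: 'n::finite tensor set)"
proof -
  have "tensor_act X t \<in> non_weyl" if "X \<in> so" "t \<in> non_weyl" for X :: "'n cmat" and t
    using that(2)
    by (induction rule: non_weyl_induct)
      (simp_all add: tensor_act_0 tensor_act_add tensor_act_tscale tensor_act_kappa tensor_act_omega that(1)
        kappa_in_non_weyl omega_in_non_weyl tens.subspace_0[OF non_weyl_subspace]
        tens.subspace_add[OF non_weyl_subspace] tens.subspace_scale[OF non_weyl_subspace])
  then show ?thesis
    by (simp add: submodule_of_def non_weyl_subspace)
qed

lemma lie_bracket_uminus: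
  "lie_bracket Y (- X) = - lie_bracket Y X" "lie_bracket Y (X - X') = lie_bracket Y X - lie_bracket Y X'"
  by (simp_all add: lie_bracket_def matrix_matrix_mult_def vec_eq_iff sum_negf sum_subtractf algebra_simps)

context hyperbolic
begin

definition "pairing Z = bilin u (Z *v v)"

text \<open>As the plane of \<open>u\<close> and \<open>v\<close> is isotropic, the matrix \<open>x\<close> has square zero, and \<open>x Z x\<close> is a multiple of
  \<open>x\<close> for every skew \<open>Z\<close>. So the square of the adjoint action of \<open>x\<close> has its image in the line of \<open>x\<close>.\<close>

lemma bracket_x_twice:
  assumes Z: "Z \<in> so"
  shows "lie_bracket x (lie_bracket x Z) = mscale (2 * pairing Z) x"
proof -
  have s: "bilin v (Z *v u) = - pairing Z" "bilin u (Z *v u) = 0" "bilin v (Z *v v) = 0"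
    using bilin_skew[OF Z, of u v] bilin_skew_self[OF Z]
    by (simp_all add: pairing_def bilin_commute[of _ "Z *v _"])
  have xu: "x *v u = 0" "x *v v = 0" "x *v (Z *v u) = - pairing Z *s u" "x *v (Z *v v) = - pairing Z *s v"
    by (simp_all add: x_mult hyp s pairing_def vec.scale_minus_left)
  have "lie_bracket x Z = - (wedge (Z *v u) v + wedge u (Z *v v))"
    unfolding lie_bracket_swap[of x Z] by (simp add: x_def lie_bracket_wedge[OF Z])
  then have "lie_bracket x (lie_bracket x Z) =
      - lie_bracket x (wedge (Z *v u) v) - lie_bracket x (wedge u (Z *v v))"
    by (simp add: lie_bracket_uminus lie_bracket_linear)
  also have "\<dots> = mscale (2 * pairing Z) x"
    by (simp add: lie_bracket_wedge[OF in_so(1)] xu wedge_simps vec.scale_minus_left mscale_uminus)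
      (simp add: x_def vec_eq_iff mscale_component)
  finally show ?thesis .
qed

text \<open>Each factor can be raised twice at most, so only the middle term of the binomial formula, with
  coefficient 6, survives.\<close>

lemma raise_four_times:
  assumes "A \<in> so" "B \<in> so"
  shows "(tensor_act x ^^ 4) (iota A * iota B) = tscale (24 * pairing A * pairing B) (iota x * iota x)"
proof -
  have 3: "lie_bracket x (mscale c x) = 0" for c
    by (simp add: lie_bracket_linear lie_bracket_self)
  let ?T = "iota (lie_bracket x (lie_bracket x A)) * iota (lie_bracket x (lie_bracket x B))"
  have "(tensor_act x ^^ 4) (iota A * iota B) = ?T + ?T + ?T + ?T + ?T + ?T"
    using assms
    by (simp add: eval_nat_numeral tensor_act_mult tensor_act_add tensor_act_iota bracket_x_twice 3 iota_0)
  also have "\<dots> = tscale (24 * pairing A * pairing B) (iota x * iota x)"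
    using assms
    by (simp add: bracket_x_twice iota_mscale tscale_mult_tscale flip: tens.scale_left_distrib)
  finally show ?thesis .
qed

lemma pairing_wedge: "pairing (wedge a b) = bilin b v * bilin u a - bilin a v * bilin u b"
  by (simp add: pairing_def wedge_mult_vec)

text \<open>On \<open>kappa\<close> the bilinear form is evaluated at pairs among \<open>u\<close> and \<open>v\<close>, where it vanishes. On
  \<open>omega\<close> the claim is the Pluecker relation for \<open>wedge u v\<close>.\<close>

lemma raise_kills_non_weyl:
  assumes "t \<in> non_weyl"
  shows "(tensor_act x ^^ 4) t = 0"
  using assms
proof (induction rule: non_weyl_induct)
  case (kappa a d)
  let ?e = "\<lambda>b. axis b 1 :: complex ^ 'n"
  have sum: "(tensor_act x ^^ 4) (sum f I) = (\<Sum>i\<in>I. (tensor_act x ^^ 4) (f i))" for f :: "'n \<Rightarrow> _" and I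
    by (induction I rule: infinite_finite_induct) (simp_all add: tensor_act_power_linear)
  have "(\<Sum>b\<in>UNIV. pairing (wedge a (?e b)) * pairing (wedge (?e b) d)) =
      bilin u a * bilin d v * bilin u v - bilin u a * bilin u d * bilin v v
      - bilin a v * bilin d v * bilin u u + bilin a v * bilin u d * bilin u v"
    unfolding bilin_def[of u v] bilin_def[of v v] bilin_def[of u u]
    by (simp add: pairing_wedge sum_distrib_left flip: sum.distrib sum_subtractf) (simp add: algebra_simps)
  also have "\<dots> = 0"
    by (simp add: hyp)
  finally have "(\<Sum>b\<in>UNIV. 24 * pairing (wedge a (?e b)) * pairing (wedge (?e b) d)) = 0"
    by (simp add: mult.assoc flip: sum_distrib_left)
  then show ?case
    by (simp add: kappa_def sum raise_four_times wedge_in_so flip: tens.scale_sum_left)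
next
  case (omega a b c d)
  have "24 * pairing (wedge a b) * pairing (wedge c d) + 24 * pairing (wedge a c) * pairing (wedge d b)
      + 24 * pairing (wedge a d) * pairing (wedge b c) = 0"
    by (simp add: pairing_wedge algebra_simps)
  then show ?case
    by (simp add: omega_def tensor_act_power_linear raise_four_times wedge_in_so flip: tens.scale_left_distrib)
qed (simp_all add: tensor_act_power_linear)

text \<open>The usual computation in an \<open>sl\<^sub>2\<close>-module of highest weight 4, where
  \<open>x y\<^sup>k\<^sup>+\<^sup>1 w = (k+1) (4-k) y\<^sup>k w\<close> and 576 is \<open>4 \<cdot> 6 \<cdot> 6 \<cdot> 4\<close>.\<close>

lemma raise_lower:
  assumes w: "w \<in> tensor_power so 2" "tensor_act x w = 0" "tensor_act h w = tscale 4 w"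
  shows "(tensor_act x ^^ 4) ((tensor_act y ^^ 4) w) = tscale 576 w"
proof -
  define W where "W k = (tensor_act y ^^ k) w" for k
  have W_Suc: "W (Suc k) = tensor_act y (W k)" for k
    by (simp add: W_def)
  have W: "W k \<in> tensor_power so 2" for k
    by (induction k) (simp_all add: W_Suc tensor_act_closed in_so, simp add: W_def w)
  have H: "tensor_act h (W k) = tscale (4 - 2 * of_nat k) (W k)" for k
  proof (induction k)
    case (Suc k)
    have "tensor_act h (W (Suc k)) = tensor_act y (tensor_act h (W k)) + tensor_act (lie_bracket h y) (W k)"
      unfolding W_Suc by (rule tensor_act_bracket[OF W])
    also have "\<dots> = tscale (4 - 2 * of_nat k) (W (Suc k)) + tscale (- 2) (W (Suc k))"
      unfolding Suc sl2 tensor_act_mscale[OF W] tensor_act_tscale W_Suc ..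
    also have "\<dots> = tscale (4 - 2 * of_nat (Suc k)) (W (Suc k))"
      by (simp only: tens.scale_left_distrib[symmetric]) (simp add: algebra_simps)
    finally show ?case .
  qed (simp add: W_def w)
  have X: "tensor_act x (W (Suc k)) = tscale (of_nat (Suc k) * (4 - of_nat k)) (W k)" for k
  proof (induction k)
    case 0
    have "tensor_act x (W 1) = tensor_act y (tensor_act x w) + tensor_act (lie_bracket x y) w"
      using tensor_act_bracket[OF w(1), of x y] by (simp only: W_def One_nat_def funpow.simps comp_def id_apply)
    then show ?case
      by (simp add: w sl2 tensor_act_0 W_def)
  next
    case (Suc k)
    have "tensor_act x (W (Suc (Suc k))) =
        tensor_act y (tensor_act x (W (Suc k))) + tensor_act (lie_bracket x y) (W (Suc k))"
      unfolding W_Suc[of "Suc k"] by (rule tensor_act_bracket[OF W])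
    also have "\<dots> = tscale (of_nat (Suc k) * (4 - of_nat k)) (W (Suc k)) +
        tscale (4 - 2 * of_nat (Suc k)) (W (Suc k))"
      by (simp only: Suc sl2 H tensor_act_tscale W_Suc[symmetric])
    also have "\<dots> = tscale (of_nat (Suc (Suc k)) * (4 - of_nat (Suc k))) (W (Suc k))"
      by (simp only: tens.scale_left_distrib[symmetric]) (simp add: algebra_simps)
    finally show ?case .
  qed
  have "(tensor_act x ^^ 4) (W 4) = tscale 576 (W 0)"
    using X[of 0] X[of 1] X[of 2] X[of 3]
    by (simp add: eval_nat_numeral tensor_act_tscale)
  then show ?thesis
    by (simp add: W_def)
qed

end

lemma invariant_projection_power:
  assumes P: "invariant_projection so (tensor_power so 2) W P" and X: "X \<in> so"
    and t: "t \<in> tensor_power so 2"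
  shows "P ((tensor_act X ^^ k) t) = (tensor_act X ^^ k) (P t) \<and> (tensor_act X ^^ k) t \<in> tensor_power so 2"
proof (induction k)
  case (Suc k)
  then show ?case
    using P X by (simp add: tensor_act_closed invariant_projection_def)
qed (simp add: t)

text \<open>The image of \<open>non_weyl\<close> under \<open>P\<close> is a submodule of the irreducible module \<open>W\<close>. If it is all of \<open>W\<close>,
  it contains \<open>y\<^sup>4 w\<close> for the highest weight vector \<open>w\<close>. But \<open>x\<^sup>4\<close> kills the image and maps \<open>y\<^sup>4 w\<close> to a
  nonzero multiple of \<open>w\<close>.\<close>

lemma projection_kills_non_weyl:
  fixes W :: "'n::finite tensor set"
  assumes n: "CARD('n) \<ge> 5" and W: "cartan_square so W"
    and P: "invariant_projection so (tensor_power so 2) W P" and t: "t \<in> non_weyl"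
  shows "P t = 0"
proof -
  obtain B th z' w where Bo: "borel_subalgebra so B"
    and z': "z' \<in> tensor_power so 1" "z' \<noteq> 0" "\<forall>X\<in>B. tensor_act X z' = tscale (th X) z'"
    and w: "w \<in> W" "w \<noteq> 0" "\<forall>X\<in>B. tensor_act X w = tscale (2 * th X) w"
    using W unfolding cartan_square_def has_highest_weight_def by blast
  have W2: "W \<subseteq> tensor_power so 2" and irr: "irreducible_submodule so W"
    using W by (auto simp: cartan_square_def)
  obtain z where z: "z' = iota z" "z \<in> so"
    using z'(1) unfolding tensor_power_1 by blast
  have z0: "z \<noteq> 0"
    using z'(2) z(1) by (auto simp: iota_0)
  have eig: "lie_bracket b z = mscale (th b) z" if "b \<in> B" for b
    using z'(3) that by (simp add: z(1) tensor_act_iota iota_inject flip: iota_mscale)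
  obtain u v where uv: "v \<noteq> 0" "u \<notin> vec.span {v}" "bilin u u = 0" "bilin u v = 0" "bilin v v = 0"
    and Bu: "\<And>b. b \<in> B \<Longrightarrow> \<exists>c d. b *v u = c *s u + d *s v"
    and Bv: "\<And>b. b \<in> B \<Longrightarrow> \<exists>c. b *v v = c *s v"
    using borel_stabilises_isotropic_plane[OF n Bo] by metis
  obtain p q where "hyperbolic u v p q"
    using hyperbolic_completion[OF uv] by blast
  then interpret hyperbolic u v p q .
  have Bv': "\<exists>c d. b *v v = c *s u + d *s v" if "b \<in> B" for b
    using Bv[OF that] by (metis add_0 vec.scale_zero_left)
  have xB: "x \<in> B" and hB: "h \<in> B"
    using borel_contains_nilradical[OF Bo Bu Bv'] by auto
  have th_h: "th h = 2"
    by (rule highest_weight_on_h[OF n Bo Bu Bv' z(2) z0 eig])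
  have w2: "w \<in> tensor_power so 2"
    using w(1) W2 by blast
  have hw: "tensor_act h w = tscale 4 w"
    using w(3) hB th_h by simp
  \<comment> \<open>The weight of \<open>x\<close> on \<open>w\<close> vanishes, since \<open>x\<close> is half the commutator of \<open>h\<close> and \<open>x\<close> in \<open>B\<close>.\<close>
  have xw: "tensor_act x w = 0"
  proof -
    have "tensor_act h (tensor_act x w) = tensor_act x (tensor_act h w) + tscale 2 (tensor_act x w)"
      using tensor_act_bracket[OF w2, of h x] by (simp add: sl2 tensor_act_mscale[OF w2])
    moreover have "tensor_act h (tensor_act x w) = tensor_act x (tensor_act h w)"
      using w(3) xB hB by (simp add: tensor_act_tscale mult.commute)
    ultimately show ?thesis by simp
  qed
  have Wmod: "tens.subspace W" "\<And>X w. X \<in> so \<Longrightarrow> w \<in> W \<Longrightarrow> tensor_act X w \<in> W"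
    using irr by (auto simp: irreducible_submodule_def submodule_of_def)
  have nw: "non_weyl \<subseteq> tensor_power (so :: 'n cmat set) 2"
    by (rule non_weyl_subset)
  have P_add: "P (r + s) = P r + P s" if "r \<in> non_weyl" "s \<in> non_weyl" for r s
    using P that nw unfolding invariant_projection_def by blast
  have P_scale: "P (tscale c r) = tscale c (P r)" if "r \<in> non_weyl" for c r
    using P that nw unfolding invariant_projection_def by blast
  have P_act: "P (tensor_act X r) = tensor_act X (P r)" if "X \<in> so" "r \<in> non_weyl" for X r
    using P that nw unfolding invariant_projection_def by blast
  have P_W: "P r \<in> W" if "r \<in> non_weyl" for r
    using P that nw unfolding invariant_projection_def by blast
  let ?U = "P ` non_weyl"
  have Mod: "tens.subspace non_weyl" "\<And>X t. X \<in> so \<Longrightarrow> t \<in> non_weyl \<Longrightarrow> tensor_act X t \<in> non_weyl"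
    using non_weyl_submodule by (auto simp: submodule_of_def)
  have P0: "P 0 = 0"
    using P_scale[OF tens.subspace_0[OF Mod(1)], of 0] by simp
  have "submodule_of so ?U"
    unfolding submodule_of_def tens.subspace_def
  proof (intro conjI ballI allI)
    show "0 \<in> ?U"
      using P0 tens.subspace_0[OF Mod(1)] by (metis image_eqI)
  next
    fix r s assume "r \<in> ?U" "s \<in> ?U"
    then obtain r' s' where rs: "r = P r'" "s = P s'" "r' \<in> non_weyl" "s' \<in> non_weyl" by blast
    then have "r + s = P (r' + s')"
      by (simp add: P_add)
    then show "r + s \<in> ?U"
      using rs tens.subspace_add[OF Mod(1)] by blast
  next
    fix c r assume "r \<in> ?U"
    then obtain r' where r: "r = P r'" "r' \<in> non_weyl" by blast
    then have "tscale c r = P (tscale c r')"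
      by (simp add: P_scale)
    then show "tscale c r \<in> ?U"
      using r tens.subspace_scale[OF Mod(1)] by blast
  next
    fix X :: "'n cmat" and r assume X: "X \<in> so" and "r \<in> ?U"
    then obtain r' where r: "r = P r'" "r' \<in> non_weyl" by blast
    then have "tensor_act X r = P (tensor_act X r')"
      by (simp add: P_act X)
    then show "tensor_act X r \<in> ?U"
      using r Mod(2)[OF X] by blast
  qed
  moreover have "?U \<subseteq> W"
    using P_W by blast
  ultimately have "?U = {0} \<or> ?U = W"
    using irr by (auto simp: irreducible_submodule_def)
  moreover have "?U \<noteq> W"
  proof
    assume UW: "?U = W"
    have "(tensor_act y ^^ k) w \<in> W" for k
      by (induction k) (simp_all add: w(1) Wmod(2) in_so)
    then obtain m where m: "m \<in> non_weyl" "(tensor_act y ^^ 4) w = P m"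
      using UW by blast
    have "tscale 576 w = (tensor_act x ^^ 4) (P m)"
      using raise_lower[OF w2 xw hw] m(2) by simp
    also have "\<dots> = P ((tensor_act x ^^ 4) m)"
      using invariant_projection_power[OF P in_so(1)] m(1) nw by (simp add: subsetD)
    also have "\<dots> = 0"
      using raise_kills_non_weyl[OF m(1)] P0 by simp
    finally show False
      using w(2) by simp
  qed
  ultimately show ?thesis
    using t by blast
qed


section \<open>The Killing form\<close>

abbreviation bvec :: "'n::finite \<Rightarrow> complex ^ 'n" where "bvec i \<equiv> axis i 1"

lemma bvec_component: "(bvec i :: complex ^ 'n::finite) $ j = (if j = i then 1 else 0)"
  by (simp add: axis_def)

lemma matrix_bvec_component: "(X *v bvec i) $ k = X $ k $ i"
proof -
  have "X $ c $ i * bvec c $ k = (if k = c then X $ c $ i else 0)" for c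
    by (simp add: bvec_component)
  then show ?thesis
    by (simp add: matrix_axis_expand)
qed

lemma vector_expand: "(\<Sum>i\<in>UNIV. (a $ i) *s bvec i) = (a :: complex ^ 'n::finite)"
proof -
  have "a $ i * (bvec i :: complex ^ 'n) $ j = (if i = j then a $ i else 0)" for i j
    by (simp add: axis_def)
  then show ?thesis
    by (simp add: vec_eq_iff)
qed

text \<open>Every index pair is counted twice, once in each order, whence the factor 1/2.\<close>

lemma so_expand:
  assumes X: "X \<in> so"
  shows "(\<Sum>i\<in>UNIV. \<Sum>j\<in>UNIV. mscale (X $ i $ j / 2) (wedge (bvec i) (bvec j))) = X"
proof -
  have "(\<Sum>i\<in>UNIV. \<Sum>j\<in>UNIV. mscale (X $ i $ j / 2) (wedge (bvec i) (bvec j))) $ k $ l = X $ k $ l" for k l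
  proof -
    have "(\<Sum>i\<in>UNIV. \<Sum>j\<in>UNIV. mscale (X $ i $ j / 2) (wedge (bvec i) (bvec j))) $ k $ l =
        (\<Sum>i\<in>UNIV. \<Sum>j\<in>UNIV. (if i = k then if j = l then X $ i $ j / 2 else 0 else 0) -
          (if i = l then if j = k then X $ i $ j / 2 else 0 else 0))"
      by (auto simp: mscale_component wedge_def bvec_component intro!: sum.cong)
    also have "\<dots> = X $ k $ l / 2 - X $ l $ k / 2"
    proof -
      have "(\<Sum>j\<in>UNIV. if i = s then if j = t then X $ i $ j / 2 else 0 else 0) =
          (if i = s then X $ i $ t / 2 else 0)" for i s t
        by simp
      then show ?thesis
        by (simp add: sum_subtractf)
    qed
    also have "\<dots> = X $ k $ l"
      by (subst so_component[OF X, of l k]) simp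
    finally show ?thesis .
  qed
  then show ?thesis by (simp add: vec_eq_iff)
qed

text \<open>The trace is independent of the basis. The matrices \<open>wedge (bvec i) (bvec j)\<close>, over all pairs \<open>(i, j)\<close>,
  form a spanning family only, but the expansion of \<open>so_expand\<close> serves as a dual family.\<close>

lemma trace_on_so:
  fixes f :: "'n::finite cmat \<Rightarrow> 'n cmat"
  assumes so: "\<And>X. X \<in> so \<Longrightarrow> f X \<in> so"
    and add: "\<And>X Y. f (X + Y) = f X + f Y" and scale: "\<And>c X. f (mscale c X) = mscale c (f X)"
  shows "trace_on so f = (\<Sum>i\<in>UNIV. \<Sum>j\<in>UNIV. f (wedge (bvec i) (bvec j)) $ i $ j) / 2"
proof -
  let ?so = "so :: 'n cmat set"
  define B where "B = (SOME B. B \<subseteq> ?so \<and> gl.independent B \<and> gl.span B = ?so)"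
  have B: "B \<subseteq> so \<and> gl.independent B \<and> gl.span B = so"
    unfolding B_def by (rule someI_ex) (use finite_gl_basis[OF so_subspace] in blast)
  obtain F where "finite F" "gl.span F = ?so"
    using finite_gl_basis[OF so_subspace] by blast
  then have fin: "finite B"
    using gl.independent_span_bound[of F B] B by auto
  let ?F = "\<lambda>i j. wedge (bvec i) (bvec j) :: 'n cmat"
  let ?c = "\<lambda>i j b. gl.representation B (?F i j) b"
  have f_sum: "f (sum g I) = (\<Sum>i\<in>I. f (g i))" for g :: "'n cmat \<Rightarrow> 'n cmat" and I
    using scale[of 0 0] by (induction I rule: infinite_finite_induct) (simp_all add: add)
  have "f (?F i j) $ i $ j = (\<Sum>b\<in>B. ?c i j b * f b $ i $ j)" for i j
  proof -
    have "?F i j = (\<Sum>b\<in>B. mscale (?c i j b) b)"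
      using B fin wedge_in_so by (intro gl.sum_representation_eq[symmetric]) auto
    then have "f (?F i j) = (\<Sum>b\<in>B. mscale (?c i j b) (f b))"
      by (metis (no_types, lifting) f_sum scale sum.cong)
    then show ?thesis
      by (simp add: mscale_component)
  qed
  then have "(\<Sum>i\<in>UNIV. \<Sum>j\<in>UNIV. f (?F i j) $ i $ j) / 2 =
      (\<Sum>i\<in>UNIV. \<Sum>j\<in>UNIV. \<Sum>b\<in>B. f b $ i $ j / 2 * ?c i j b)"
    by (simp add: sum_divide_distrib mult.commute)
  also have "\<dots> = (\<Sum>b\<in>B. \<Sum>i\<in>UNIV. \<Sum>j\<in>UNIV. f b $ i $ j / 2 * ?c i j b)"
    by (simp add: sum.swap[of _ B])
  \<comment> \<open>Expand \<open>f b\<close> in the spanning family and then in the basis \<open>B\<close>.\<close>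
  also have "\<dots> = (\<Sum>b\<in>B. gl.representation B (f b) b)"
  proof (intro sum.cong refl)
    fix b assume b: "b \<in> B"
    have rep_sum: "gl.representation B (sum g I) = (\<lambda>b. \<Sum>i\<in>I. gl.representation B (g i) b)"
      if "\<And>i. g i \<in> so" for g :: "'n \<Rightarrow> 'n cmat" and I
      using B that by (intro gl.representation_sum) auto
    have mem: "mscale c (?F i j) \<in> so" for c i j
      by (intro gl.subspace_scale[OF so_subspace] wedge_in_so)
    have mem2: "(\<Sum>j\<in>UNIV. mscale (g j) (?F i j)) \<in> so" for g i
      by (intro gl.subspace_sum[OF so_subspace] mem)
    have rs: "gl.representation B (mscale c (?F i j)) b = c * ?c i j b" for c i j
    proof -
      have "?F i j \<in> gl.span B"
        using B wedge_in_so by blast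
      from gl.representation_scale[OF conjunct1[OF conjunct2[OF B]] this, of c]
      have "gl.representation B (mscale c (?F i j)) = (\<lambda>b. c * ?c i j b)" .
      then show ?thesis by (rule fun_cong)
    qed
    have "gl.representation B (\<Sum>i\<in>UNIV. \<Sum>j\<in>UNIV. mscale (f b $ i $ j / 2) (?F i j)) b =
        (\<Sum>i\<in>UNIV. \<Sum>j\<in>UNIV. f b $ i $ j / 2 * ?c i j b)"
      by (simp only: rep_sum mem mem2 rs)
    then show "(\<Sum>i\<in>UNIV. \<Sum>j\<in>UNIV. f b $ i $ j / 2 * ?c i j b) = gl.representation B (f b) b"
      using so_expand[of "f b"] so[of b] B b by auto
  qed
  finally show ?thesis
    unfolding trace_on_def Let_def B_def[symmetric] by simp
qed

lemma killing_form_so: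
  fixes X Y :: "'n::finite cmat"
  assumes X: "X \<in> so" and Y: "Y \<in> so"
  shows "killing_form so X Y = (of_nat CARD('n) - 2) * (\<Sum>i\<in>UNIV. \<Sum>j\<in>UNIV. X $ i $ j * Y $ j $ i)"
proof -
  let ?n = "of_nat CARD('n) :: complex"
  let ?t = "\<Sum>i\<in>UNIV. \<Sum>j\<in>UNIV. X $ i $ j * Y $ j $ i"
  let ?F = "\<lambda>i j. wedge (bvec i) (bvec j) :: 'n cmat"
  have diag: "Z $ i $ i = 0" if "Z \<in> so" for Z :: "'n cmat" and i
    using so_component[OF that, of i i] by simp
  have comp: "wedge a b $ i $ j = a $ i * b $ j - b $ i * a $ j" for a b :: "complex ^ 'n" and i j
    by (simp add: wedge_def)
  have XY: "(X *v (Y *v bvec i)) $ k = (\<Sum>j\<in>UNIV. X $ k $ j * Y $ j $ i)" for i k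
    by (simp add: matrix_vector_mul_assoc matrix_bvec_component) (simp add: matrix_matrix_mult_def)
  have tr: "?t = (\<Sum>i\<in>UNIV. (X *v (Y *v bvec i)) $ i)"
    by (simp add: XY)
  have "(lie_bracket X \<circ> lie_bracket Y) (?F i j) $ i $ j =
     ((X *v (Y *v bvec i)) $ i - (if i = j then (X *v (Y *v bvec i)) $ i else 0)) - X $ i $ j * Y $ j $ i - Y $ i $ j * X $ j $ i
     + ((X *v (Y *v bvec j)) $ j - (if i = j then (X *v (Y *v bvec j)) $ j else 0))" for i j
    by (simp add: lie_bracket_wedge X Y lie_bracket_linear comp bvec_component matrix_bvec_component diag)
  then have "(\<Sum>i\<in>UNIV. \<Sum>j\<in>UNIV. (lie_bracket X \<circ> lie_bracket Y) (?F i j) $ i $ j) =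
    (\<Sum>i\<in>UNIV. \<Sum>j\<in>UNIV. (X *v (Y *v bvec i)) $ i - (if i = j then (X *v (Y *v bvec i)) $ i else 0))
    - ?t - (\<Sum>i\<in>UNIV. \<Sum>j\<in>UNIV. Y $ i $ j * X $ j $ i)
    + (\<Sum>i\<in>UNIV. \<Sum>j\<in>UNIV. (X *v (Y *v bvec j)) $ j - (if i = j then (X *v (Y *v bvec j)) $ j else 0))"
    by (simp only: sum.distrib sum_subtractf)
  also have "(\<Sum>i\<in>UNIV. \<Sum>j\<in>UNIV. Y $ i $ j * X $ j $ i) = ?t"
    by (subst sum.swap) (simp add: mult.commute)
  also have "(\<Sum>i\<in>UNIV. \<Sum>j\<in>UNIV. (X *v (Y *v bvec i)) $ i - (if i = j then (X *v (Y *v bvec i)) $ i else 0)) = ?n * ?t - ?t"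
    by (simp only: tr) (simp add: sum_subtractf sum_distrib_left)
  also have "(\<Sum>i\<in>UNIV. \<Sum>j\<in>UNIV. (X *v (Y *v bvec j)) $ j - (if i = j then (X *v (Y *v bvec j)) $ j else 0)) = ?n * ?t - ?t"
    by (simp only: tr) (simp add: sum_subtractf)
  finally have eq: "(\<Sum>i\<in>UNIV. \<Sum>j\<in>UNIV. (lie_bracket X \<circ> lie_bracket Y) (?F i j) $ i $ j) =
    ?n * ?t - ?t - ?t - ?t + (?n * ?t - ?t)" .
  have "(\<Sum>i\<in>UNIV. \<Sum>j\<in>UNIV. (lie_bracket X \<circ> lie_bracket Y) (?F i j) $ i $ j) / 2 = (?n - 2) * ?t"
    unfolding eq by (simp add: field_simps)
  then show ?thesis
    unfolding killing_form_def
    by (subst trace_on_so) (simp_all add: so_bracket X Y lie_bracket_linear)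
qed

lemma killing_form_wedge:
  fixes a b c d :: "complex ^ 'n::finite"
  shows "killing_form so (wedge a b) (wedge c d) =
    2 * (of_nat CARD('n) - 2) * (bilin a d * bilin b c - bilin a c * bilin b d)"
proof -
  have "(\<Sum>i\<in>UNIV. \<Sum>j\<in>UNIV. wedge a b $ i $ j * wedge c d $ j $ i) =
      (\<Sum>i\<in>UNIV. \<Sum>j\<in>UNIV. (a $ i * d $ i) * (b $ j * c $ j) - (a $ i * c $ i) * (b $ j * d $ j) -
        (b $ i * d $ i) * (a $ j * c $ j) + (b $ i * c $ i) * (a $ j * d $ j))"
    by (simp add: wedge_def algebra_simps)
  also have "\<dots> = bilin a d * bilin b c - bilin a c * bilin b d - bilin b d * bilin a c + bilin b c * bilin a d"
    by (simp add: bilin_def sum_product sum.distrib sum_subtractf)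
  finally have eq: "(\<Sum>i\<in>UNIV. \<Sum>j\<in>UNIV. wedge a b $ i $ j * wedge c d $ j $ i) =
      bilin a d * bilin b c - bilin a c * bilin b d - bilin b d * bilin a c + bilin b c * bilin a d" .
  show ?thesis
    unfolding killing_form_so[OF wedge_in_so wedge_in_so] eq by (simp add: algebra_simps)
qed

lemma sum_bracket_kappa:
  fixes a d :: "complex ^ 'n::finite"
  shows "(\<Sum>b\<in>UNIV. lie_bracket (wedge a (bvec b)) (wedge (bvec b) d)) = mscale (of_nat CARD('n) - 2) (wedge a d)"
proof -
  have "lie_bracket (wedge a (bvec b)) (wedge (bvec b) d) =
      wedge a d - wedge ((a $ b) *s bvec b) d - wedge a ((d $ b) *s bvec b)" for b
    by (simp add: lie_bracket_wedge wedge_in_so wedge_mult_vec wedge_simps bvec_component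
        wedge_swap[of "bvec b" a] mscale_uminus)
  then have "(\<Sum>b\<in>UNIV. lie_bracket (wedge a (bvec b)) (wedge (bvec b) d)) =
      (\<Sum>b\<in>(UNIV :: 'n set). wedge a d) - wedge (\<Sum>b\<in>UNIV. (a $ b) *s bvec b) d - wedge a (\<Sum>b\<in>UNIV. (d $ b) *s bvec b)"
    by (simp only: sum_subtractf wedge_sum)
  also have "(\<Sum>b\<in>(UNIV :: 'n set). wedge a d) = mscale (of_nat CARD('n)) (wedge a d)"
    by (simp only: vec_eq_iff mscale_component sum_component) simp
  also have "mscale (of_nat CARD('n)) (wedge a d) - wedge (\<Sum>b\<in>UNIV. (a $ b) *s bvec b) d
      - wedge a (\<Sum>b\<in>UNIV. (d $ b) *s bvec b) = mscale (of_nat CARD('n) - 2) (wedge a d)"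
    unfolding vector_expand by (simp only: vec_eq_iff mscale_component vector_minus_component) (simp add: algebra_simps)
  finally show ?thesis .
qed

lemma sum_killing_kappa:
  fixes a d :: "complex ^ 'n::finite"
  shows "(\<Sum>b\<in>UNIV. killing_form so (wedge a (bvec b)) (wedge (bvec b) d)) =
    2 * (of_nat CARD('n) - 2) * (of_nat CARD('n) - 1) * bilin a d"
proof -
  have "(\<Sum>b\<in>UNIV. killing_form so (wedge a (bvec b)) (wedge (bvec b) d)) =
      2 * (of_nat CARD('n) - 2) * (\<Sum>b\<in>(UNIV :: 'n set). bilin a d - a $ b * d $ b)"
    by (simp add: killing_form_wedge bvec_component sum_distrib_left)
  also have "(\<Sum>b\<in>(UNIV :: 'n set). bilin a d - a $ b * d $ b) = (of_nat CARD('n) - 1) * bilin a d"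
    by (simp add: sum_subtractf bilin_def left_diff_distrib)
  finally show ?thesis by (simp add: mult.assoc)
qed

lemma sum_bracket_omega:
  "lie_bracket (wedge a b) (wedge c d) + lie_bracket (wedge a c) (wedge d b) + lie_bracket (wedge a d) (wedge b c)
    = mscale 2 (mscale (bilin a b) (wedge c d) - mscale (bilin a c) (wedge b d) + mscale (bilin a d) (wedge b c))"
  by (simp add: lie_bracket_wedge wedge_in_so wedge_mult_vec wedge_simps bilin_commute[of c b]
      bilin_commute[of d b] bilin_commute[of d c])
    (simp add: vec_eq_iff mscale_component wedge_def algebra_simps)


section \<open>Relations modulo the ideal\<close>

definition relator :: "('n::finite tensor \<Rightarrow> 'n tensor) \<Rightarrow> complex \<Rightarrow> 'n cmat \<Rightarrow> 'n cmat \<Rightarrow> 'n tensor" where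
  "relator P lam X Y = iota X * iota Y - P (iota X * iota Y) - tscale (1 / 2) (iota (lie_bracket X Y))
     - scalar (lam * killing_form so X Y)"

lemma scalar_eq_tscale: "scalar c = tscale c 1"
  by (simp add: tscale_def)

lemma scalar_sum: "scalar (sum f A) = (\<Sum>i\<in>A. scalar (f i))"
  by (simp only: scalar_eq_tscale tens.scale_sum_left)

lemma iota_in_carrier: "X \<in> L \<Longrightarrow> iota X \<in> carrier (tensor_algebra L)"
  unfolding carrier_tensor_algebra by (intro tens.span_base CollectI exI[of _ "[X]"]) simp

lemma scalar_in_carrier: "scalar c \<in> carrier (tensor_algebra L)"
  unfolding carrier_tensor_algebra scalar_eq_tscale
  by (intro tens.span_scale tens.span_base CollectI exI[of _ "[]"]) simp

lemma ideal_facts: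
  assumes I: "ideal I (tensor_algebra L)"
  shows "tens.subspace I"
    and "X \<in> L \<Longrightarrow> t \<in> I \<Longrightarrow> iota X * t \<in> I" and "X \<in> L \<Longrightarrow> t \<in> I \<Longrightarrow> t * iota X \<in> I"
proof -
  interpret ideal I "tensor_algebra L" by (rule I)
  show "iota X * t \<in> I" if "X \<in> L" "t \<in> I"
    using I_l_closed[OF that(2) iota_in_carrier[OF that(1)]] by (simp add: tensor_algebra_def)
  show "t * iota X \<in> I" if "X \<in> L" "t \<in> I"
    using I_r_closed[OF that(2) iota_in_carrier[OF that(1)]] by (simp add: tensor_algebra_def)
  show "tens.subspace I"
    unfolding tens.subspace_def
  proof (intro conjI ballI allI)
    show "0 \<in> I" using additive_subgroup.zero_closed[OF ideal.axioms(1)[OF I]] by (simp add: tensor_algebra_def)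
    show "s + t \<in> I" if "s \<in> I" "t \<in> I" for s t
      using additive_subgroup.a_closed[OF ideal.axioms(1)[OF I] that] by (simp add: tensor_algebra_def)
    show "tscale c t \<in> I" if "t \<in> I" for c t
      using I_l_closed[OF that scalar_in_carrier] by (simp add: tensor_algebra_def tscale_def)
  qed
qed

lemma projection_sum:
  assumes P: "invariant_projection so (tensor_power so 2) W P"
    and f: "\<And>i. i \<in> A \<Longrightarrow> f i \<in> tensor_power so 2"
  shows "P (sum f A) = (\<Sum>i\<in>A. P (f i))"
proof -
  have zero: "0 \<in> tensor_power so 2"
    by (rule tens.subspace_0[OF tensor_power_2_subspace])
  then have "P (tscale 0 0) = tscale 0 (P 0)"
    using P unfolding invariant_projection_def by blast
  then have P0: "P 0 = 0" by simp
  have add: "P (s + t) = P s + P t" if "s \<in> tensor_power so 2" "t \<in> tensor_power so 2" for s t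
    using P that unfolding invariant_projection_def by blast
  show ?thesis
    using f
    by (induction A rule: infinite_finite_induct)
      (simp_all add: P0 add tens.subspace_sum[OF tensor_power_2_subspace])
qed

text \<open>An ideal that contains the relations. The constants \<open>nu\<close> and \<open>mu\<close> are the coefficients in
  \<open>kappa_relation\<close>.\<close>

locale quadratic_quotient =
  fixes W :: "'n::finite tensor set" and P :: "'n tensor \<Rightarrow> 'n tensor" and lam :: complex
    and I :: "'n tensor set" and nu mu :: complex
  assumes nu_def: "nu = (of_nat CARD('n) - 2) / 2"
    and mu_def: "mu = 2 * lam * (of_nat CARD('n) - 1) * (of_nat CARD('n) - 2)"
    and n: "CARD('n) \<ge> 5" and W: "cartan_square so W"
    and P: "invariant_projection so (tensor_power so 2) W P"
    and I: "ideal I (tensor_algebra so)"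
    and rel: "\<And>X Y. X \<in> so \<Longrightarrow> Y \<in> so \<Longrightarrow> relator P lam X Y \<in> I"
begin

lemmas sub = ideal_facts(1)[OF I]
lemmas I_left = ideal_facts(2)[OF I wedge_in_so] and I_right = ideal_facts(3)[OF I wedge_in_so]

text \<open>Sum of the relations over the terms of \<open>kappa\<close>, on which \<open>P\<close> vanishes.\<close>

lemma kappa_relation: "kappa a d - tscale nu (iota (wedge a d)) - tscale (mu * bilin a d) 1 \<in> I"
proof -
  let ?N = "of_nat CARD('n) :: complex"
  have coeff: "lam * (2 * (?N - 2) * (?N - 1) * bilin a d) = mu * bilin a d"
    unfolding mu_def by (simp only: mult_ac)
  have "(\<Sum>b\<in>UNIV. relator P lam (wedge a (bvec b)) (wedge (bvec b) d)) \<in> I"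
    by (intro tens.subspace_sum[OF sub] rel wedge_in_so)
  also have "(\<Sum>b\<in>UNIV. relator P lam (wedge a (bvec b)) (wedge (bvec b) d)) =
      kappa a d - P (kappa a d) -
      tscale (1 / 2) (iota (\<Sum>b\<in>UNIV. lie_bracket (wedge a (bvec b)) (wedge (bvec b) d))) -
      scalar (lam * (\<Sum>b\<in>UNIV. killing_form so (wedge a (bvec b)) (wedge (bvec b) d)))"
    unfolding kappa_def
    by (subst projection_sum[OF P])
      (simp_all add: relator_def sum_subtractf iota_mult_in_tensor_power_2 wedge_in_so iota_sum
        tens.scale_sum_right scalar_sum sum_distrib_left)
  also have "\<dots> = kappa a d - tscale nu (iota (wedge a d)) - tscale (mu * bilin a d) 1"
    unfolding sum_bracket_kappa sum_killing_kappa coeff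
    by (simp add: projection_kills_non_weyl[OF n W P kappa_in_non_weyl] iota_mscale scalar_eq_tscale nu_def)
  finally show ?thesis .
qed

text \<open>The Killing form contributes nothing, as the traces over the cyclic permutations add up to zero.\<close>

lemma omega_relation:
  "omega a b c d - (tscale (bilin a b) (iota (wedge c d)) - tscale (bilin a c) (iota (wedge b d))
     + tscale (bilin a d) (iota (wedge b c))) \<in> I"
proof -
  let ?R = "relator P lam"
  let ?k = "killing_form so"
  have "?R (wedge a b) (wedge c d) + ?R (wedge a c) (wedge d b) + ?R (wedge a d) (wedge b c) \<in> I"
    by (intro tens.subspace_add[OF sub] rel wedge_in_so)
  also have "?R (wedge a b) (wedge c d) + ?R (wedge a c) (wedge d b) + ?R (wedge a d) (wedge b c) =
      omega a b c d - P (omega a b c d) -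
      tscale (1 / 2) (iota (lie_bracket (wedge a b) (wedge c d) + lie_bracket (wedge a c) (wedge d b)
        + lie_bracket (wedge a d) (wedge b c))) -
      scalar (lam * (?k (wedge a b) (wedge c d) + ?k (wedge a c) (wedge d b) + ?k (wedge a d) (wedge b c)))"
  proof -
    have add: "P (s + t) = P s + P t" if "s \<in> tensor_power so 2" "t \<in> tensor_power so 2" for s t
      using P that unfolding invariant_projection_def by blast
    show ?thesis
      by (simp add: omega_def relator_def add iota_mult_in_tensor_power_2 wedge_in_so
          tens.subspace_add[OF tensor_power_2_subspace] iota_add tens.scale_right_distrib
          scalar_simps distrib_left)
  qed
  also have "?k (wedge a b) (wedge c d) + ?k (wedge a c) (wedge d b) + ?k (wedge a d) (wedge b c) = 0"
    unfolding killing_form_wedge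
    by (simp add: bilin_commute[of c b] bilin_commute[of d b] bilin_commute[of d c] algebra_simps)
  finally show ?thesis
    by (simp add: projection_kills_non_weyl[OF n W P omega_in_non_weyl] sum_bracket_omega
        iota_mscale iota_add iota_diff scalar_simps)
qed

lemma iota_expand:
  "(\<Sum>c\<in>UNIV. tscale (a $ c) (iota (wedge x (bvec c)))) = iota (wedge x a)"
  "(\<Sum>c\<in>UNIV. tscale (a $ c) (iota (wedge (bvec c) x))) = iota (wedge a x)"
proof -
  have "iota (wedge x (\<Sum>c\<in>UNIV. (a $ c) *s bvec c)) =
        (\<Sum>c\<in>UNIV. tscale (a $ c) (iota (wedge x (bvec c))))"
    "iota (wedge (\<Sum>c\<in>UNIV. (a $ c) *s bvec c) x) =
        (\<Sum>c\<in>UNIV. tscale (a $ c) (iota (wedge (bvec c) x)))"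
    by (simp_all only: wedge_sum wedge_simps iota_sum iota_mscale)
  then show "(\<Sum>c\<in>UNIV. tscale (a $ c) (iota (wedge x (bvec c)))) = iota (wedge x a)"
    "(\<Sum>c\<in>UNIV. tscale (a $ c) (iota (wedge (bvec c) x))) = iota (wedge a x)"
    by (simp_all only: vector_expand)
qed

text \<open>The relation for \<open>omega\<close> is multiplied by \<open>wedge (bvec d) (bvec c)\<close> and summed over \<open>c\<close> and \<open>d\<close>. In each
  term, two adjacent factors then share a summation index, so that \<open>kappa\<close> appears.\<close>

lemma contraction:
  fixes a b :: "complex ^ 'n"
  defines "C \<equiv> (\<Sum>c\<in>UNIV. kappa (bvec c) (bvec c)) :: 'n tensor"
  shows "(\<Sum>c\<in>UNIV. \<Sum>d\<in>UNIV. (omega a b (bvec c) (bvec d) -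
      (tscale (bilin a b) (iota (wedge (bvec c) (bvec d))) - tscale (a $ c) (iota (wedge b (bvec d)))
       + tscale (a $ d) (iota (wedge b (bvec c))))) * iota (wedge (bvec d) (bvec c))) =
    iota (wedge a b) * C - (\<Sum>c\<in>UNIV. iota (wedge a (bvec c)) * kappa b (bvec c))
      - (\<Sum>c\<in>UNIV. iota (wedge a (bvec c)) * kappa b (bvec c))
      - tscale (bilin a b) C + kappa b a + kappa b a" (is "?L = ?R")
proof -
  let ?w = "\<lambda>a b. iota (wedge a b) :: 'n tensor"
  have sw: "?w (bvec d) x = - ?w x (bvec d)" for d x
    by (simp add: wedge_swap[of "bvec d" x] iota_minus)
  have lin: "(\<Sum>c\<in>UNIV. tscale (a $ c) (?w x (bvec c))) = ?w x a"
       "(\<Sum>c\<in>UNIV. tscale (a $ c) (?w (bvec c) x)) = ?w a x" for x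
    by (simp_all only: iota_expand)
  have 1: "(\<Sum>c\<in>UNIV. \<Sum>d\<in>UNIV. ?w a b * ?w (bvec c) (bvec d) * ?w (bvec d) (bvec c)) = ?w a b * C"
    by (simp add: C_def kappa_def sum_distrib_left mult.assoc)
  have 2: "(\<Sum>c\<in>UNIV. \<Sum>d\<in>UNIV. ?w a (bvec c) * ?w (bvec d) b * ?w (bvec d) (bvec c)) =
      - (\<Sum>c\<in>UNIV. ?w a (bvec c) * kappa b (bvec c))"
    by (simp add: kappa_def sum_distrib_left mult.assoc sw[of _ b] sum_negf)
  have 3: "(\<Sum>c\<in>UNIV. \<Sum>d\<in>UNIV. ?w a (bvec d) * ?w b (bvec c) * ?w (bvec d) (bvec c)) =
      - (\<Sum>c\<in>UNIV. ?w a (bvec c) * kappa b (bvec c))"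
  proof -
    have "(\<Sum>c\<in>UNIV. \<Sum>d\<in>UNIV. ?w a (bvec d) * ?w b (bvec c) * ?w (bvec d) (bvec c)) =
        (\<Sum>d\<in>UNIV. \<Sum>c\<in>UNIV. - (?w a (bvec d) * (?w b (bvec c) * ?w (bvec c) (bvec d))))"
      by (subst sum.swap, intro sum.cong refl, subst sw) (simp add: mult.assoc)
    then show ?thesis
      by (simp add: kappa_def sum_distrib_left sum_negf)
  qed
  have 4: "(\<Sum>c\<in>UNIV. \<Sum>d\<in>UNIV. tscale (bilin a b) (?w (bvec c) (bvec d)) * ?w (bvec d) (bvec c)) =
      tscale (bilin a b) C"
    by (simp add: C_def kappa_def tens.scale_sum_right tscale_mult_left)
  have 5: "(\<Sum>c\<in>UNIV. \<Sum>d\<in>UNIV. tscale (a $ c) (?w b (bvec d)) * ?w (bvec d) (bvec c)) = kappa b a"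
  proof -
    have "(\<Sum>c\<in>UNIV. \<Sum>d\<in>UNIV. tscale (a $ c) (?w b (bvec d)) * ?w (bvec d) (bvec c)) =
        (\<Sum>d\<in>UNIV. ?w b (bvec d) * (\<Sum>c\<in>UNIV. tscale (a $ c) (?w (bvec d) (bvec c))))"
      by (subst sum.swap) (simp add: sum_distrib_left tscale_mult_left tscale_mult_right)
    then show ?thesis
      by (simp add: lin kappa_def)
  qed
  have 6: "(\<Sum>c\<in>UNIV. \<Sum>d\<in>UNIV. tscale (a $ d) (?w b (bvec c)) * ?w (bvec d) (bvec c)) = - kappa b a"
  proof -
    have "(\<Sum>c\<in>UNIV. \<Sum>d\<in>UNIV. tscale (a $ d) (?w b (bvec c)) * ?w (bvec d) (bvec c)) =
        (\<Sum>c\<in>UNIV. ?w b (bvec c) * (\<Sum>d\<in>UNIV. tscale (a $ d) (?w (bvec d) (bvec c))))"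
      by (simp add: sum_distrib_left tscale_mult_left tscale_mult_right)
    also have "\<dots> = (\<Sum>c\<in>UNIV. - (?w b (bvec c) * ?w (bvec c) a))"
      by (simp add: lin sw[of _ a])
    finally show ?thesis
      by (simp add: kappa_def sum_negf)
  qed
  have "?L = (\<Sum>c\<in>UNIV. \<Sum>d\<in>UNIV. ?w a b * ?w (bvec c) (bvec d) * ?w (bvec d) (bvec c))
    + (\<Sum>c\<in>UNIV. \<Sum>d\<in>UNIV. ?w a (bvec c) * ?w (bvec d) b * ?w (bvec d) (bvec c))
    + (\<Sum>c\<in>UNIV. \<Sum>d\<in>UNIV. ?w a (bvec d) * ?w b (bvec c) * ?w (bvec d) (bvec c))
    - ((\<Sum>c\<in>UNIV. \<Sum>d\<in>UNIV. tscale (bilin a b) (?w (bvec c) (bvec d)) * ?w (bvec d) (bvec c))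
    - (\<Sum>c\<in>UNIV. \<Sum>d\<in>UNIV. tscale (a $ c) (?w b (bvec d)) * ?w (bvec d) (bvec c))
    + (\<Sum>c\<in>UNIV. \<Sum>d\<in>UNIV. tscale (a $ d) (?w b (bvec c)) * ?w (bvec d) (bvec c)))"
    unfolding omega_def by (simp only: distrib_right left_diff_distrib sum.distrib sum_subtractf)
  then show ?thesis
    unfolding 1 2 3 4 5 6 by simp
qed

text \<open>Reducing every \<open>kappa\<close> in the contracted relation by \<open>kappa_relation\<close> leaves only a multiple of
  \<open>wedge a b\<close>. The coefficient is \<open>n mu - 2 mu + 2 nu\<^sup>2 - 2 nu\<close>, which equals
  \<open>(n-2) (mu + (n-4)/2)\<close>, and it vanishes at the exceptional value of \<open>lam\<close> only.\<close>

lemma wedge_in_ideal: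
  assumes lam: "lam \<noteq> - ((of_nat CARD('n) - 4) / (4 * (of_nat CARD('n) - 1) * (of_nat CARD('n) - 2)))"
  shows "iota (wedge a b) \<in> I"
proof -
  let ?N = "of_nat CARD('n) :: complex"
  let ?w = "iota (wedge a b)"
  let ?C = "(\<Sum>c\<in>UNIV. kappa (bvec c) (bvec c)) :: 'n tensor"
  let ?Q = "(\<Sum>c\<in>UNIV. iota (wedge a (bvec c)) * kappa b (bvec c)) :: 'n tensor"
  let ?b = "bilin a b"
  have "(\<Sum>c\<in>UNIV. \<Sum>d\<in>UNIV. (omega a b (bvec c) (bvec d) -
      (tscale (bilin a b) (iota (wedge (bvec c) (bvec d))) - tscale (a $ c) (iota (wedge b (bvec d)))
       + tscale (a $ d) (iota (wedge b (bvec c))))) * iota (wedge (bvec d) (bvec c))) \<in> I"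
    by (intro tens.subspace_sum[OF sub] I_right omega_relation[of a b "bvec _" "bvec _", unfolded bilin_axis])
  then have R: "?w * ?C - ?Q - ?Q - tscale ?b ?C + kappa b a + kappa b a \<in> I"
    unfolding contraction .
  have C: "?C - tscale (?N * mu) 1 \<in> I"
  proof -
    have "(\<Sum>c\<in>(UNIV :: 'n set). kappa (bvec c) (bvec c) - tscale nu (iota (wedge (bvec c) (bvec c)))
        - tscale (mu * bilin (bvec c) (bvec c)) 1) \<in> I"
      by (intro tens.subspace_sum[OF sub] kappa_relation)
    moreover have "(\<Sum>c\<in>(UNIV :: 'n set). tscale mu 1) = tscale (?N * mu) (1 :: 'n tensor)"
      using tens.scale_sum_left[of "\<lambda>_. mu" "UNIV :: 'n set" "1 :: 'n tensor"] by simp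
    ultimately show ?thesis
      by (simp add: wedge_simps iota_0 bvec_component sum_subtractf del: sum_constant)
  qed
  have Q: "?Q + tscale nu (kappa a b) - tscale mu ?w \<in> I"
  proof -
    have "(\<Sum>c\<in>UNIV. iota (wedge a (bvec c)) * (kappa b (bvec c) - tscale nu (iota (wedge b (bvec c)))
        - tscale (mu * bilin b (bvec c)) 1)) \<in> I"
      by (intro tens.subspace_sum[OF sub] I_left kappa_relation)
    also have "(\<Sum>c\<in>UNIV. iota (wedge a (bvec c)) * (kappa b (bvec c) - tscale nu (iota (wedge b (bvec c)))
        - tscale (mu * bilin b (bvec c)) 1)) =
        ?Q - tscale nu (\<Sum>c\<in>UNIV. iota (wedge a (bvec c)) * iota (wedge b (bvec c)))
          - tscale mu (\<Sum>c\<in>UNIV. tscale (b $ c) (iota (wedge a (bvec c))))"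
      by (simp add: right_diff_distrib sum_subtractf tscale_mult_right tens.scale_sum_right)
    also have "(\<Sum>c\<in>UNIV. iota (wedge a (bvec c)) * iota (wedge b (bvec c))) = - kappa a b"
      by (simp add: kappa_def wedge_swap[of "bvec _" b] iota_minus sum_negf)
    also have "(\<Sum>c\<in>UNIV. tscale (b $ c) (iota (wedge a (bvec c)))) = ?w"
      by (rule iota_expand)
    finally show ?thesis
      by simp
  qed
  have k1: "kappa a b - tscale nu ?w - tscale (mu * ?b) 1 \<in> I"
    by (rule kappa_relation)
  have k2: "kappa b a + tscale nu ?w - tscale (mu * ?b) 1 \<in> I"
    using kappa_relation[of b a] by (simp add: wedge_swap[of b a] iota_minus bilin_commute[of b a])
  \<comment> \<open>Starting from the contraction, the multiples of the other elements of \<open>I\<close> are chosen to cancel all terms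
    with \<open>kappa\<close>. The scalar terms then cancel as well, because \<open>2 nu = n - 2\<close>.\<close>
  have "(?w * ?C - ?Q - ?Q - tscale ?b ?C + kappa b a + kappa b a)
      - ?w * (?C - tscale (?N * mu) 1) + tscale 2 (?Q + tscale nu (kappa a b) - tscale mu ?w)
      + tscale ?b (?C - tscale (?N * mu) 1)
      - tscale (2 * nu) (kappa a b - tscale nu ?w - tscale (mu * ?b) 1)
      - tscale 2 (kappa b a + tscale nu ?w - tscale (mu * ?b) 1) \<in> I" (is "?E \<in> I")
    by (intro tens.subspace_add[OF sub] tens.subspace_diff[OF sub] tens.subspace_scale[OF sub] I_left R C Q k1 k2)
  moreover have "?E = tscale ((?N - 2) * (mu + (?N - 4) / 2)) ?w"
  proof -
    have two: "tscale 2 t = t + t" for t :: "'n tensor"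
      using tens.scale_left_distrib[of 1 1 t] by simp
    have coeff: "(?N - 2) * (mu + (?N - 4) / 2) = ?N * mu - 2 * mu + 2 * nu * nu - 2 * nu"
      "- ?b * ?N * mu + 2 * nu * mu * ?b + 2 * mu * ?b = 0"
      unfolding nu_def by (simp_all add: field_simps)
    have "?E = tscale (?N * mu - 2 * mu + 2 * nu * nu - 2 * nu) ?w
        + tscale (- ?b * ?N * mu + 2 * nu * mu * ?b + 2 * mu * ?b) 1"

      by (simp add: right_diff_distrib tscale_mult_right tens.scale_right_diff_distrib
          tens.scale_right_distrib tens.scale_left_distrib tens.scale_left_diff_distrib two mult.assoc)
    then show ?thesis
      unfolding coeff by simp
  qed
  ultimately have w: "tscale ((?N - 2) * (mu + (?N - 4) / 2)) ?w \<in> I"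
    by simp
  have "?N - 2 \<noteq> 0" "?N - 1 \<noteq> 0"
    using n of_nat_eq_iff[of "CARD('n)" 2, where ?'a = complex] of_nat_eq_iff[of "CARD('n)" 1, where ?'a = complex] by auto
  moreover have "mu + (?N - 4) / 2 \<noteq> 0"
  proof
    assume "mu + (?N - 4) / 2 = 0"
    then have "4 * lam * (?N - 1) * (?N - 2) = - (?N - 4)"
      unfolding mu_def by (simp add: field_simps)
    then have "lam * (4 * (?N - 1) * (?N - 2)) = - (?N - 4)"
      by (simp only: mult_ac)
    moreover have "4 * (?N - 1) * (?N - 2) \<noteq> 0"
      using \<open>?N - 2 \<noteq> 0\<close> \<open>?N - 1 \<noteq> 0\<close> by simp
    ultimately have "lam = - (?N - 4) / (4 * (?N - 1) * (?N - 2))"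
      by (simp only: eq_divide_eq) simp
    then have "lam = - ((?N - 4) / (4 * (?N - 1) * (?N - 2)))"
      by (simp only: minus_divide_left)
    with lam show False by blast
  qed
  ultimately obtain k where k: "k \<noteq> 0" "tscale k ?w \<in> I"
    using w by (metis mult_eq_0_iff)
  then show ?thesis
    using tens.subspace_scale[OF sub k(2), of "inverse k"] by simp
qed

end

theorem theorem2p1:
  fixes lam :: complex
    and W :: "'n::finite tensor set"
    and P :: "'n tensor \<Rightarrow> 'n tensor"
  assumes "CARD('n) \<ge> 5"
    and "lam \<noteq> - ((of_nat CARD('n) - 4) / (4 * (of_nat CARD('n) - 1) * (of_nat CARD('n) - 2)))"
    and "cartan_square so W"
    and "invariant_projection so (tensor_power so 2) W P"
  shows "tensor_power so 1 \<subseteq> Idl\<^bsub>tensor_algebra so\<^esub>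
    {iota X * iota Y - P (iota X * iota Y) - tscale (1 / 2) (iota (lie_bracket X Y))
       - scalar (lam * killing_form so X Y) | X Y. X \<in> so \<and> Y \<in> so}"
proof -
  have "iota X \<in> I" if "ideal I (tensor_algebra so)"
    and G: "{iota X * iota Y - P (iota X * iota Y) - tscale (1 / 2) (iota (lie_bracket X Y))
       - scalar (lam * killing_form so X Y) | X Y. X \<in> so \<and> Y \<in> so} \<subseteq> I" and X: "X \<in> so" for I X
  proof -
    have rel: "relator P lam X Y \<in> I" if "X \<in> so" "Y \<in> so" for X Y
      unfolding relator_def using G that by blast
    interpret quadratic_quotient W P lam I "(of_nat CARD('n) - 2) / 2"
      "2 * lam * (of_nat CARD('n) - 1) * (of_nat CARD('n) - 2)"
      by (rule quadratic_quotient.intro) (fact refl assms that rel)+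
    have "iota (\<Sum>i\<in>UNIV. \<Sum>j\<in>UNIV. mscale (X $ i $ j / 2) (wedge (bvec i) (bvec j))) \<in> I"
      unfolding iota_sum iota_mscale
      by (intro tens.subspace_sum[OF sub] tens.subspace_scale[OF sub] wedge_in_ideal assms(2))
    then show ?thesis
      by (simp only: so_expand[OF X])
  qed
  then show ?thesis
    unfolding genideal_def tensor_power_1 by blast
qed

end
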